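(* Let $\Gamma$ be a finite abelian group. The following three equalities hold: $$\exp_\times(\mathrm{ARI}(\Gamma)_{\mathrm{al}})=\mathrm{GARI}(\Gamma)_{\mathrm{as}},\qquad \exp_\times(\overline{\mathrm{ARI}}(\Gamma)_{\mathrm{al}})=\overline{\mathrm{GARI}}(\Gamma)_{\mathrm{as}},\qquad \exp_\times(\overline{\mathrm{ARI}}(\Gamma)_{\mathrm{il}})=\overline{\mathrm{GARI}}(\Gamma)_{\mathrm{is}}.$$
   Context: Moulds. $\Gamma$ is a finite abelian group, written multiplicatively. A mould is a sequence $M=(M(x_1,\dots,x_m))_{m\ge 0}$ with $M(\emptyset)\in\mathbb{Q}$ and, for $m\ge1$, $M(x_1,\dots,x_m)$ a family of rational functions $M_{\sigma_1,\dots,\sigma_m}(x_1,\dots,x_m)\in\mathbb{Q}(x_1,\dots,x_m)$ indexed by $(\sigma_1,\dots,\sigma_m)\in\Gamma^{m}$. $\mathrm{BIMU}(\Gamma)$ and $\overline{\mathrm{BIMU}}(\Gamma)$ are two copies of the set of all moulds; for the first the variables are called $u_i$ and components are written $M\binom{u_1,\dots,u_m}{\sigma_1,\dots,\sigma_m}$, for the second the variables are called $v_i$ and components are written $M\binom{\sigma_1,\dots,\sigma_m}{v_1,\dots,v_m}$. Each is a $\mathbb{Q}$-vector space componentwise and a unital associative algebra with product $(A\times B)_{\sigma_1,\dots,\sigma_m}(x_1,\dots,x_m)=\sum_{i=0}^m A_{\sigma_1,\dots,\sigma_i}(x_1,\dots,x_i)B_{\sigma_{i+1},\dots,\sigma_m}(x_{i+1},\dots,x_m)$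 and unit $I=(1,0,0,\dots)$. $\mathrm{ARI}(\Gamma)$ (resp. $\mathrm{GARI}(\Gamma)$) is the set of $M\in\mathrm{BIMU}(\Gamma)$ with $M(\emptyset)=0$ (resp. $=1$); $\overline{\mathrm{ARI}}(\Gamma)$, $\overline{\mathrm{GARI}}(\Gamma)$ are defined likewise from $\overline{\mathrm{BIMU}}(\Gamma)$. The map $\exp_\times:\mathrm{ARI}(\Gamma)\to\mathrm{GARI}(\Gamma)$ (and likewise $\overline{\mathrm{ARI}}(\Gamma)\to\overline{\mathrm{GARI}}(\Gamma)$) is $\exp_\times(A)=\sum_{k\ge0}\frac1{k!}A^{\times k}$, where $A^{\times k}$ is the $k$-fold $\times$-power, $A^{\times0}=I$ (the sum is finite in each depth $m$). Words. $V_{\mathbb Z}$ is the set of letters $\binom{\sigma}{v}$ with $\sigma\in\Gamma$ and $v$ a $\mathbb{Z}$-linear combination of $v_1,v_2,\dots$; $V_{\mathbb Z}^\bullet$ is the free monoid on it, with empty word $\emptyset$; $U_{\mathbb Z}$, $U_{\mathbb Z}^\bullet$ are defined in the same way with letters $\binom{u}{\sigma}$. For a word $\alpha$ with letters $\binom{\sigma_1}{w_1},\dots,\binom{\sigma_m}{w_m}$ (resp. $\binom{w_1}{\sigma_1},\dots,\binom{w_m}{\sigma_m}$), $M(\alpha):=M_{\sigma_1,\dots,\sigma_m}(w_1,\dots,w_m)$. Let $\mathcal K=\mathbb{Q}(v_i\mid i\ge1)$. Shuffles. On the span ($\mathbb{Q}$-span of $U_{\mathbb Z}^\bullet$, $\mathcal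 K$-span of $V_{\mathbb Z}^\bullet$) define the bilinear product $\sqcup\!\sqcup$ with unit $\emptyset$ by $a\omega\sqcup\!\sqcup b\eta=a(\omega\sqcup\!\sqcup b\eta)+b(a\omega\sqcup\!\sqcup\eta)$ for letters $a,b$ and words $\omega,\eta$. On the $\mathcal K$-span of $V_{\mathbb Z}^\bullet$ define also the $\mathcal K$-bilinear product $\sqcup\!\sqcup_*$ with unit $\emptyset$ by, for $v\ne v'$, $\binom{\sigma}{v}\omega\sqcup\!\sqcup_*\binom{\sigma'}{v'}\eta=\binom{\sigma}{v}(\omega\sqcup\!\sqcup_*\binom{\sigma'}{v'}\eta)+\binom{\sigma'}{v'}(\binom{\sigma}{v}\omega\sqcup\!\sqcup_*\eta)+\frac1{v-v'}\{\binom{\sigma\sigma'}{v}(\omega\sqcup\!\sqcup_*\eta)-\binom{\sigma\sigma'}{v'}(\omega\sqcup\!\sqcup_*\eta)\}$, the product being $0$ if $v=v'$. Let $\mathrm{Sh}\binom{\omega;\eta}{\alpha}$ and $\mathrm{Sh}_*\binom{\omega;\eta}{\alpha}$ be the coefficients of the word $\alpha$ in $\omega\sqcup\!\sqcup\eta$ and $\omega\sqcup\!\sqcup_*\eta$. Symmetry types. A mould $M$ in $\mathrm{ARI}(\Gamma)$ (resp. $\mathrm{GARI}(\Gamma)$) is alternal (resp. symmetral) if for all $p,q\ge1$ and all $\sigma_i\in\Gamma$, with $\omega=\binom{u_1,\dots,u_p}{\sigma_1,\dots,\sigma_p}$, $\eta=\binom{u_{p+1},\dots,u_{p+q}}{\sigma_{p+1},\dots,\sigma_{p+q}}$,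 one has $\sum_\alpha\mathrm{Sh}\binom{\omega;\eta}{\alpha}M(\alpha)=0$ (resp. $=M(\omega)M(\eta)$). The same definition, with $\omega=\binom{\sigma_1,\dots,\sigma_p}{v_1,\dots,v_p}$, $\eta=\binom{\sigma_{p+1},\dots,\sigma_{p+q}}{v_{p+1},\dots,v_{p+q}}$, is used in $\overline{\mathrm{ARI}}(\Gamma)$ (resp. $\overline{\mathrm{GARI}}(\Gamma)$). A mould in $\overline{\mathrm{ARI}}(\Gamma)$ (resp. $\overline{\mathrm{GARI}}(\Gamma)$) is alternil (resp. symmetril) if the latter identity holds with $\mathrm{Sh}_*$ in place of $\mathrm{Sh}$. The subscripts $\mathrm{al},\mathrm{as},\mathrm{il},\mathrm{is}$ denote the subsets of alternal, symmetral, alternil, symmetril moulds. *)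

theory Defs
  imports
    Complex_Main
    "HOL-Library.Poly_Mapping"
    "HOL-Computational_Algebra.Fraction_Field"
    "HOL-Algebra.Group"
begin

section \<open>Rational functions over the rationals\<close>

text \<open>
  Polynomials with rational coefficients in countably many variables, as finitely supported
  functions from exponent vectors to coefficients, and their field of fractions.
  Variables are counted from 0: the index \<open>i\<close> stands for the variable usually written
  \<open>x\<close>, \<open>u\<close> or \<open>v\<close> with subscript \<open>i + 1\<close>. Hence \<open>ratfun\<close> is the field of rational
  functions in all \<open>v\<close> with subscript at least 1, without any additional variable.
\<close>

type_synonym rat_mpoly = "(nat \<Rightarrow>\<^sub>0 nat) \<Rightarrow>\<^sub>0 rat"
type_synonym ratfun = "rat_mpoly fract"

definition rat_const :: "rat \<Rightarrow> ratfun" where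
  "rat_const c = Fraction_Field.Fract (Poly_Mapping.single 0 c) 1"

definition ratfun_var :: "nat \<Rightarrow> ratfun" where
  "ratfun_var i =
    Fraction_Field.Fract (Poly_Mapping.single (Poly_Mapping.single i 1) 1) 1"

definition mpoly_vars :: "rat_mpoly \<Rightarrow> nat set" where
  "mpoly_vars p = (\<Union>t\<in>Poly_Mapping.keys p. Poly_Mapping.keys t)"

text \<open>The subfield of rational functions in the first \<open>m\<close> variables; the rationals for \<open>m = 0\<close>.\<close>

definition ratfuns :: "nat \<Rightarrow> ratfun set" where
  "ratfuns m = {Fraction_Field.Fract p q | p q.
     q \<noteq> 0 \<and> mpoly_vars p \<subseteq> {..<m} \<and> mpoly_vars q \<subseteq> {..<m}}"

definition mpoly_eval :: "(nat \<Rightarrow> ratfun) \<Rightarrow> rat_mpoly \<Rightarrow> ratfun" where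
  "mpoly_eval w p = (\<Sum>t\<in>Poly_Mapping.keys p. rat_const (Poly_Mapping.lookup p t) *
     (\<Prod>i\<in>Poly_Mapping.keys t. w i ^ Poly_Mapping.lookup t i))"

text \<open>
  Substitution of \<open>w i\<close> for the variable \<open>i\<close> in a rational function. The value is determined by
  any representing fraction whose denominator does not vanish after the substitution; it is
  unspecified if there is no such fraction. Below, only substitutions of pairwise distinct
  variables matter, and for these there always is one.
\<close>

definition ratfun_subst :: "(nat \<Rightarrow> ratfun) \<Rightarrow> ratfun \<Rightarrow> ratfun" where
  "ratfun_subst w f = (THE y. \<exists>p q. f = Fraction_Field.Fract p q \<and>
     mpoly_eval w q \<noteq> 0 \<and> y = mpoly_eval w p / mpoly_eval w q)"

text \<open>Formal integral linear combinations of the variables.\<close>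

type_synonym lin_comb = "nat \<Rightarrow>\<^sub>0 int"

abbreviation lin_var :: "nat \<Rightarrow> lin_comb" where
  "lin_var i \<equiv> Poly_Mapping.single i 1"

definition lin_form :: "lin_comb \<Rightarrow> ratfun" where
  "lin_form w = (\<Sum>i\<in>Poly_Mapping.keys w. of_int (Poly_Mapping.lookup w i) * ratfun_var i)"


section \<open>Moulds\<close>

text \<open>
  The value of a mould at the list \<open>[\<sigma>\<^sub>1, \<dots>, \<sigma>\<^sub>m]\<close> is its component, a rational function
  of the first \<open>m\<close> variables. Components with an index outside the group are set to 0,
  so that equality of moulds is equality of functions.
\<close>

type_synonym 'g mould = "'g list \<Rightarrow> ratfun"

definition BIMU :: "('g, 'b) monoid_scheme \<Rightarrow> 'g mould set" where
  "BIMU \<Gamma> = {M. (\<forall>\<sigma>s. set \<sigma>s \<subseteq> carrier \<Gamma> \<longrightarrow> M \<sigma>s \<in> ratfuns (length \<sigma>s)) \<and>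
                (\<forall>\<sigma>s. \<not> set \<sigma>s \<subseteq> carrier \<Gamma> \<longrightarrow> M \<sigma>s = 0)}"

text \<open>The second copy of the set of moulds, whose variables are called \<open>v\<close>.\<close>

abbreviation BIMU_bar :: "('g, 'b) monoid_scheme \<Rightarrow> 'g mould set" where
  "BIMU_bar \<Gamma> \<equiv> BIMU \<Gamma>"

definition mould_at :: "'g mould \<Rightarrow> 'g list \<Rightarrow> lin_comb list \<Rightarrow> ratfun" where
  "mould_at M \<sigma>s ws = ratfun_subst (\<lambda>i. lin_form (ws ! i)) (M \<sigma>s)"

definition mould_mult :: "'g mould \<Rightarrow> 'g mould \<Rightarrow> 'g mould" where
  "mould_mult A B = (\<lambda>\<sigma>s. let xs = map lin_var [0..<length \<sigma>s] in
     \<Sum>i\<le>length \<sigma>s. mould_at A (take i \<sigma>s) (take i xs) * mould_at B (drop i \<sigma>s) (drop i xs))"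

definition mould_one :: "'g mould" where
  "mould_one = (\<lambda>\<sigma>s. if \<sigma>s = [] then 1 else 0)"

primrec mould_power :: "'g mould \<Rightarrow> nat \<Rightarrow> 'g mould" where
  "mould_power A 0 = mould_one"
| "mould_power A (Suc k) = mould_mult A (mould_power A k)"

definition ARI :: "('g, 'b) monoid_scheme \<Rightarrow> 'g mould set" where
  "ARI \<Gamma> = {M \<in> BIMU \<Gamma>. M [] = 0}"

definition GARI :: "('g, 'b) monoid_scheme \<Rightarrow> 'g mould set" where
  "GARI \<Gamma> = {M \<in> BIMU \<Gamma>. M [] = 1}"

definition ARI_bar :: "('g, 'b) monoid_scheme \<Rightarrow> 'g mould set" where
  "ARI_bar \<Gamma> = {M \<in> BIMU_bar \<Gamma>. M [] = 0}"

definition GARI_bar :: "('g, 'b) monoid_scheme \<Rightarrow> 'g mould set" where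
  "GARI_bar \<Gamma> = {M \<in> BIMU_bar \<Gamma>. M [] = 1}"

text \<open>
  \<open>Sum_any\<close> is the sum of the nonzero terms. For \<open>A [] = 0\<close> these are finitely many, since
  the \<open>k\<close>-th power of \<open>A\<close> vanishes at all lists of length less than \<open>k\<close>.
\<close>

definition mould_exp :: "'g mould \<Rightarrow> 'g mould" where
  "mould_exp A = (\<lambda>\<sigma>s. Sum_any (\<lambda>k. rat_const (1 / fact k) * mould_power A k \<sigma>s))"


section \<open>Words and shuffle products\<close>

type_synonym 'g u_letter = "lin_comb \<times> 'g"
type_synonym 'g v_letter = "'g \<times> lin_comb"

definition mould_at_u :: "'g mould \<Rightarrow> 'g u_letter list \<Rightarrow> ratfun" where
  "mould_at_u M \<alpha> = mould_at M (map snd \<alpha>) (map fst \<alpha>)"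

definition mould_at_v :: "'g mould \<Rightarrow> 'g v_letter list \<Rightarrow> ratfun" where
  "mould_at_v M \<alpha> = mould_at M (map fst \<alpha>) (map snd \<alpha>)"

text \<open>
  The span of the words over \<open>'a\<close> with coefficients in \<open>'k\<close> is \<open>'a list \<Rightarrow>\<^sub>0 'k\<close>.
  \<open>lcons a\<close> is the linear extension of \<open>\<omega> \<mapsto> a\<omega>\<close>. The shuffle products are bilinear and
  hence given by their values on pairs of words, which is how they are defined here.
\<close>

definition lcons :: "'a \<Rightarrow> ('a list \<Rightarrow>\<^sub>0 'k::comm_ring_1) \<Rightarrow> ('a list \<Rightarrow>\<^sub>0 'k)" where
  "lcons a x =
    (\<Sum>\<omega>\<in>Poly_Mapping.keys x. Poly_Mapping.single (a # \<omega>) (Poly_Mapping.lookup x \<omega>))"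

definition scale :: "'k \<Rightarrow> ('a list \<Rightarrow>\<^sub>0 'k::comm_ring_1) \<Rightarrow> ('a list \<Rightarrow>\<^sub>0 'k)" where
  "scale c x = Poly_Mapping.map ((*) c) x"

fun shuffle :: "'a list \<Rightarrow> 'a list \<Rightarrow> ('a list \<Rightarrow>\<^sub>0 'k::comm_ring_1)" where
  "shuffle [] \<eta> = Poly_Mapping.single \<eta> 1"
| "shuffle \<omega> [] = Poly_Mapping.single \<omega> 1"
| "shuffle (a # \<omega>) (b # \<eta>) = lcons a (shuffle \<omega> (b # \<eta>)) + lcons b (shuffle (a # \<omega>) \<eta>)"

fun shuffle_star :: "('g, 'b) monoid_scheme \<Rightarrow>
    'g v_letter list \<Rightarrow> 'g v_letter list \<Rightarrow> ('g v_letter list \<Rightarrow>\<^sub>0 ratfun)" where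
  "shuffle_star \<Gamma> [] \<eta> = Poly_Mapping.single \<eta> 1"
| "shuffle_star \<Gamma> \<omega> [] = Poly_Mapping.single \<omega> 1"
| "shuffle_star \<Gamma> ((\<sigma>, v) # \<omega>) ((\<sigma>', v') # \<eta>) =
    (if v = v' then 0
     else lcons (\<sigma>, v) (shuffle_star \<Gamma> \<omega> ((\<sigma>', v') # \<eta>))
        + lcons (\<sigma>', v') (shuffle_star \<Gamma> ((\<sigma>, v) # \<omega>) \<eta>)
        + scale (1 / (lin_form v - lin_form v'))
            (lcons (\<sigma> \<otimes>\<^bsub>\<Gamma>\<^esub> \<sigma>', v) (shuffle_star \<Gamma> \<omega> \<eta>)
           - lcons (\<sigma> \<otimes>\<^bsub>\<Gamma>\<^esub> \<sigma>', v') (shuffle_star \<Gamma> \<omega> \<eta>)))"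

definition Sh_u :: "'g u_letter list \<Rightarrow> 'g u_letter list \<Rightarrow> 'g u_letter list \<Rightarrow> rat" where
  "Sh_u \<omega> \<eta> \<alpha> = Poly_Mapping.lookup (shuffle \<omega> \<eta>) \<alpha>"

definition Sh_v :: "'g v_letter list \<Rightarrow> 'g v_letter list \<Rightarrow> 'g v_letter list \<Rightarrow> ratfun" where
  "Sh_v \<omega> \<eta> \<alpha> = Poly_Mapping.lookup (shuffle \<omega> \<eta>) \<alpha>"

definition Sh_star :: "('g, 'b) monoid_scheme \<Rightarrow>
    'g v_letter list \<Rightarrow> 'g v_letter list \<Rightarrow> 'g v_letter list \<Rightarrow> ratfun" where
  "Sh_star \<Gamma> \<omega> \<eta> \<alpha> = Poly_Mapping.lookup (shuffle_star \<Gamma> \<omega> \<eta>) \<alpha>"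


section \<open>Symmetry types\<close>

text \<open>
  The sums over all words \<open>\<alpha>\<close> have finitely many nonzero coefficients, hence \<open>Sum_any\<close>.
  With indices from 0, the words below have the letters with indices \<open>0, \<dots>, p - 1\<close> and
  \<open>p, \<dots>, p + q - 1\<close>.
\<close>

definition u_word :: "(nat \<Rightarrow> 'g) \<Rightarrow> nat \<Rightarrow> nat \<Rightarrow> 'g u_letter list" where
  "u_word \<sigma> i j = map (\<lambda>k. (lin_var k, \<sigma> k)) [i..<j]"

definition v_word :: "(nat \<Rightarrow> 'g) \<Rightarrow> nat \<Rightarrow> nat \<Rightarrow> 'g v_letter list" where
  "v_word \<sigma> i j = map (\<lambda>k. (\<sigma> k, lin_var k)) [i..<j]"

definition ARI_al :: "('g, 'b) monoid_scheme \<Rightarrow> 'g mould set" where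
  "ARI_al \<Gamma> = {M \<in> ARI \<Gamma>. \<forall>p\<ge>1. \<forall>q\<ge>1. \<forall>\<sigma>. (\<forall>i<p + q. \<sigma> i \<in> carrier \<Gamma>) \<longrightarrow>
     (let \<omega> = u_word \<sigma> 0 p; \<eta> = u_word \<sigma> p (p + q) in
      Sum_any (\<lambda>\<alpha>. rat_const (Sh_u \<omega> \<eta> \<alpha>) * mould_at_u M \<alpha>) = 0)}"

definition GARI_as :: "('g, 'b) monoid_scheme \<Rightarrow> 'g mould set" where
  "GARI_as \<Gamma> = {M \<in> GARI \<Gamma>. \<forall>p\<ge>1. \<forall>q\<ge>1. \<forall>\<sigma>. (\<forall>i<p + q. \<sigma> i \<in> carrier \<Gamma>) \<longrightarrow>
     (let \<omega> = u_word \<sigma> 0 p; \<eta> = u_word \<sigma> p (p + q) in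
      Sum_any (\<lambda>\<alpha>. rat_const (Sh_u \<omega> \<eta> \<alpha>) * mould_at_u M \<alpha>)
        = mould_at_u M \<omega> * mould_at_u M \<eta>)}"

definition ARI_bar_al :: "('g, 'b) monoid_scheme \<Rightarrow> 'g mould set" where
  "ARI_bar_al \<Gamma> = {M \<in> ARI_bar \<Gamma>. \<forall>p\<ge>1. \<forall>q\<ge>1. \<forall>\<sigma>. (\<forall>i<p + q. \<sigma> i \<in> carrier \<Gamma>) \<longrightarrow>
     (let \<omega> = v_word \<sigma> 0 p; \<eta> = v_word \<sigma> p (p + q) in
      Sum_any (\<lambda>\<alpha>. Sh_v \<omega> \<eta> \<alpha> * mould_at_v M \<alpha>) = 0)}"

definition GARI_bar_as :: "('g, 'b) monoid_scheme \<Rightarrow> 'g mould set" where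
  "GARI_bar_as \<Gamma> = {M \<in> GARI_bar \<Gamma>. \<forall>p\<ge>1. \<forall>q\<ge>1. \<forall>\<sigma>. (\<forall>i<p + q. \<sigma> i \<in> carrier \<Gamma>) \<longrightarrow>
     (let \<omega> = v_word \<sigma> 0 p; \<eta> = v_word \<sigma> p (p + q) in
      Sum_any (\<lambda>\<alpha>. Sh_v \<omega> \<eta> \<alpha> * mould_at_v M \<alpha>)
        = mould_at_v M \<omega> * mould_at_v M \<eta>)}"

definition ARI_bar_il :: "('g, 'b) monoid_scheme \<Rightarrow> 'g mould set" where
  "ARI_bar_il \<Gamma> = {M \<in> ARI_bar \<Gamma>. \<forall>p\<ge>1. \<forall>q\<ge>1. \<forall>\<sigma>. (\<forall>i<p + q. \<sigma> i \<in> carrier \<Gamma>) \<longrightarrow>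
     (let \<omega> = v_word \<sigma> 0 p; \<eta> = v_word \<sigma> p (p + q) in
      Sum_any (\<lambda>\<alpha>. Sh_star \<Gamma> \<omega> \<eta> \<alpha> * mould_at_v M \<alpha>) = 0)}"

definition GARI_bar_is :: "('g, 'b) monoid_scheme \<Rightarrow> 'g mould set" where
  "GARI_bar_is \<Gamma> = {M \<in> GARI_bar \<Gamma>. \<forall>p\<ge>1. \<forall>q\<ge>1. \<forall>\<sigma>. (\<forall>i<p + q. \<sigma> i \<in> carrier \<Gamma>) \<longrightarrow>
     (let \<omega> = v_word \<sigma> 0 p; \<eta> = v_word \<sigma> p (p + q) in
      Sum_any (\<lambda>\<alpha>. Sh_star \<Gamma> \<omega> \<eta> \<alpha> * mould_at_v M \<alpha>)
        = mould_at_v M \<omega> * mould_at_v M \<eta>)}"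

end

theory Submission
  imports Defs
begin

text \<open>
  A mould is a functional on words, and the product of moulds is the convolution dual to
  deconcatenation. Deconcatenation is multiplicative for both shuffle products, so a functional
  \<open>F\<close> that vanishes on products of nonempty words satisfies a binomial formula for the values of its
  convolution powers on products, and its exponential is multiplicative. Conversely, on a product of
  two words the nonlinear terms of the exponential only involve products of smaller total length,
  so that induction shows that a functional with multiplicative exponential vanishes on products of
  nonempty words. Every mould in GARI is an exponential by recursion on the depth.
  The symmetry conditions are only imposed on words in the standard variables; they extend to all
  words in distinct variables because everything commutes with injective renamings of variables.
\<close>

section \<open>Convolution and quasi-shuffles of functionals on words\<close>

text \<open>Deconcatenation is compatible with any contraction term
  \<open>\<kappa> a b * (l a b - r a b)\<close>, since a contracted letter is never cut in two; so
  one recursion serves both shuffle products. The obstacle is that mould functionals are under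
  control only at words in pairwise distinct variables: elsewhere \<open>v - v'\<close> and the
  denominator of a component may become 0. Hence the algebra is relative to a predicate
  \<open>Q\<close> on pairs of words that passes to pairs of prefixes and to pairs of suffixes, and
  vanishing on products is assumed only below a bound \<open>n\<close> on the total length, which is
  what the converse direction needs for its induction. The coefficients of the series enter through
  \<open>c 0 = 1\<close>, \<open>c 1 = 1\<close> and
  \<open>of_nat (k choose i) * c k = c i * c (k - i)\<close>: these say that k! times
  \<open>c k\<close> is 1, without division in the ring of values.\<close>

definition conv :: "('a list \<Rightarrow> 'k::comm_ring_1) \<Rightarrow> ('a list \<Rightarrow> 'k) \<Rightarrow> 'a list \<Rightarrow> 'k" where
  "conv F G \<alpha> = (\<Sum>i\<le>length \<alpha>. F (take i \<alpha>) * G (drop i \<alpha>))"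

definition conv2 :: "('a list \<Rightarrow> 'a list \<Rightarrow> 'k::comm_ring_1) \<Rightarrow> ('a list \<Rightarrow> 'a list \<Rightarrow> 'k) \<Rightarrow>
    'a list \<Rightarrow> 'a list \<Rightarrow> 'k" where
  "conv2 f g \<omega> \<eta> = (\<Sum>i\<le>length \<omega>. \<Sum>j\<le>length \<eta>.
     f (take i \<omega>) (take j \<eta>) * g (drop i \<omega>) (drop j \<eta>))"

definition conv_one :: "'a list \<Rightarrow> 'k::comm_ring_1" where
  "conv_one \<alpha> = (if \<alpha> = [] then 1 else 0)"

primrec conv_power :: "('a list \<Rightarrow> 'k::comm_ring_1) \<Rightarrow> nat \<Rightarrow> 'a list \<Rightarrow> 'k" where
  "conv_power F 0 = conv_one"
| "conv_power F (Suc k) = conv F (conv_power F k)"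

text \<open>The cut before the first letter is separated from the later ones, which matches the way
  \<open>qsh\<close> moves a letter into the functional.\<close>

lemma conv_Cons: "conv F G (a # \<alpha>) = F [] * G (a # \<alpha>) + conv (\<lambda>\<alpha>. F (a # \<alpha>)) G \<alpha>"
  by (simp add: conv_def sum.atMost_Suc_shift del: sum.atMost_Suc)

text \<open>A word of length below \<open>k\<close> cannot be cut into \<open>k\<close> nonempty
  pieces, so every summand contains a factor \<open>F []\<close>.\<close>

lemma conv_power_eq_0: "F [] = 0 \<Longrightarrow> length \<alpha> < k \<Longrightarrow> conv_power F k \<alpha> = 0"
proof (induction k arbitrary: \<alpha>)
  case (Suc k)
  have "F (take i \<alpha>) * conv_power F k (drop i \<alpha>) = 0" if "i \<le> length \<alpha>" for i
    using that Suc by (cases i) auto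
  then show ?case by (simp add: conv_def)
qed simp

locale quasi_shuffle =
  fixes \<kappa> :: "'a \<Rightarrow> 'a \<Rightarrow> 'k::comm_ring_1" and l r :: "'a \<Rightarrow> 'a \<Rightarrow> 'a"
begin

text \<open>
  \<open>qsh F \<omega> \<eta>\<close> is the value of the linear extension of \<open>F\<close> at the quasi-shuffle product of \<open>\<omega>\<close> and
  \<open>\<eta>\<close> in which two letters \<open>a\<close> and \<open>b\<close> contract to \<open>\<kappa> a b (l a b - r a b)\<close>.
\<close>

fun qsh :: "('a list \<Rightarrow> 'k) \<Rightarrow> 'a list \<Rightarrow> 'a list \<Rightarrow> 'k" where
  "qsh F [] \<eta> = F \<eta>"
| "qsh F \<omega> [] = F \<omega>"
| "qsh F (a # \<omega>) (b # \<eta>) = qsh (\<lambda>\<alpha>. F (a # \<alpha>)) \<omega> (b # \<eta>) + qsh (\<lambda>\<alpha>. F (b # \<alpha>)) (a # \<omega>) \<eta>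
     + \<kappa> a b * (qsh (\<lambda>\<alpha>. F (l a b # \<alpha>)) \<omega> \<eta> - qsh (\<lambda>\<alpha>. F (r a b # \<alpha>)) \<omega> \<eta>)"

text \<open>A superset of the support of the product: contracted words are listed even where
  \<open>\<kappa>\<close> vanishes. It serves to use facts about \<open>F\<close> that hold only at
  words of bounded length or with distinct variables.\<close>

fun qsh_words :: "'a list \<Rightarrow> 'a list \<Rightarrow> 'a list set" where
  "qsh_words [] \<eta> = {\<eta>}"
| "qsh_words \<omega> [] = {\<omega>}"
| "qsh_words (a # \<omega>) (b # \<eta>) = Cons a ` qsh_words \<omega> (b # \<eta>) \<union> Cons b ` qsh_words (a # \<omega>) \<eta>
     \<union> Cons (l a b) ` qsh_words \<omega> \<eta> \<union> Cons (r a b) ` qsh_words \<omega> \<eta>"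

lemma qsh_Nil_right [simp]: "qsh F \<omega> [] = F \<omega>"
  by (cases \<omega>) auto

lemma qsh_cong: "(\<And>\<alpha>. \<alpha> \<in> qsh_words \<omega> \<eta> \<Longrightarrow> F \<alpha> = G \<alpha>) \<Longrightarrow> qsh F \<omega> \<eta> = qsh G \<omega> \<eta>"
proof (induction \<omega> \<eta> arbitrary: F G rule: qsh_words.induct)
  case (3 a \<omega> b \<eta>)
  have "qsh (\<lambda>\<alpha>. F (a # \<alpha>)) \<omega> (b # \<eta>) = qsh (\<lambda>\<alpha>. G (a # \<alpha>)) \<omega> (b # \<eta>)"
    "qsh (\<lambda>\<alpha>. F (b # \<alpha>)) (a # \<omega>) \<eta> = qsh (\<lambda>\<alpha>. G (b # \<alpha>)) (a # \<omega>) \<eta>"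
    "qsh (\<lambda>\<alpha>. F (l a b # \<alpha>)) \<omega> \<eta> = qsh (\<lambda>\<alpha>. G (l a b # \<alpha>)) \<omega> \<eta>"
    "qsh (\<lambda>\<alpha>. F (r a b # \<alpha>)) \<omega> \<eta> = qsh (\<lambda>\<alpha>. G (r a b # \<alpha>)) \<omega> \<eta>"
    by (rule 3; use "3.prems" in simp)+
  then show ?case by simp
qed auto

lemma length_qsh_words: "\<alpha> \<in> qsh_words \<omega> \<eta> \<Longrightarrow> length \<alpha> \<le> length \<omega> + length \<eta>"
  by (induction \<omega> \<eta> arbitrary: \<alpha> rule: qsh_words.induct) (auto, fastforce+)

lemma qsh_add: "qsh (\<lambda>\<alpha>. F \<alpha> + G \<alpha>) \<omega> \<eta> = qsh F \<omega> \<eta> + qsh G \<omega> \<eta>"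
  by (induction \<omega> \<eta> arbitrary: F G rule: qsh_words.induct) (simp_all add: algebra_simps)

lemma qsh_mult: "qsh (\<lambda>\<alpha>. c * F \<alpha>) \<omega> \<eta> = c * qsh F \<omega> \<eta>"
  by (induction \<omega> \<eta> arbitrary: F rule: qsh_words.induct) (simp_all add: algebra_simps)

lemma qsh_zero [simp]: "qsh (\<lambda>\<alpha>. 0) \<omega> \<eta> = 0"
  using qsh_mult[of 0 "\<lambda>_. 0"] by simp

lemma qsh_sum: "qsh (\<lambda>\<alpha>. \<Sum>k\<in>I. F k \<alpha>) \<omega> \<eta> = (\<Sum>k\<in>I. qsh (F k) \<omega> \<eta>)"
  by (induction I rule: infinite_finite_induct) (simp_all add: qsh_add)

lemma qsh_conv_one: "qsh conv_one \<omega> \<eta> = conv_one \<omega> * conv_one \<eta>"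
  by (cases \<omega>; cases \<eta>) (simp_all add: conv_one_def)

text \<open>A cut of a word in the product either precedes its first letter, which contributes
  \<open>F [] * qsh G \<omega> \<eta>\<close>, or leaves that letter, contracted or not, in the left
  piece. In the second case the induction hypothesis applies to \<open>F\<close> with the letter
  absorbed; hence \<open>F\<close> varies and \<open>G\<close> is fixed.\<close>

lemma qsh_conv: "qsh (conv F G) \<omega> \<eta> = conv2 (qsh F) (qsh G) \<omega> \<eta>"
proof (induction \<omega> \<eta> arbitrary: F rule: qsh_words.induct)
  case (1 \<eta>)
  then show ?case by (simp add: conv_def conv2_def)
next
  case (2 a \<omega>)
  then show ?case by (simp add: conv_def conv2_def)
next
  case (3 a \<omega> b \<eta>)
  have *: "(\<lambda>\<alpha>. conv F G (c # \<alpha>)) = (\<lambda>\<alpha>. F [] * G (c # \<alpha>) + conv (\<lambda>\<alpha>. F (c # \<alpha>)) G \<alpha>)" for c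
    by (simp add: conv_Cons)
  show ?case
    by (simp add: * qsh_add qsh_mult 3)
       (simp add: conv2_def sum.atMost_Suc_shift sum.distrib sum_subtractf sum_distrib_left
          algebra_simps del: sum.atMost_Suc)
qed

end

lemma conv_one_left: "(\<Sum>i\<le>length \<alpha>. conv_one (take i \<alpha>) * h (drop i \<alpha>)) = h \<alpha>"
proof -
  have "(\<Sum>i\<le>length \<alpha>. conv_one (take i \<alpha>) * h (drop i \<alpha>)) = (\<Sum>i\<in>{0}. h (drop i \<alpha>))"
    by (rule sum.mono_neutral_cong_right) (auto simp: conv_one_def)
  then show ?thesis by simp
qed

lemma conv_cong:
  "(\<And>i. i \<le> length \<alpha> \<Longrightarrow> F (take i \<alpha>) = F' (take i \<alpha>)) \<Longrightarrow>
   (\<And>i. i \<le> length \<alpha> \<Longrightarrow> G (drop i \<alpha>) = G' (drop i \<alpha>)) \<Longrightarrow> conv F G \<alpha> = conv F' G' \<alpha>"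
  by (simp add: conv_def)

section \<open>Binomial formula for convolution powers on products\<close>

text \<open>The value at \<omega> \<otimes> \<eta> of the \<open>k\<close>-th power of F \<otimes> 1
  + 1 \<otimes> F, where 1 is \<open>conv_one\<close>, expanded by the binomial theorem for two
  commuting terms.\<close>

definition binomial_tensor :: "('a list \<Rightarrow> 'k::comm_ring_1) \<Rightarrow> nat \<Rightarrow> 'a list \<Rightarrow> 'a list \<Rightarrow> 'k" where
  "binomial_tensor F k \<omega> \<eta> =
     (\<Sum>i\<le>k. of_nat (k choose i) * (conv_power F i \<omega> * conv_power F (k - i) \<eta>))"

text \<open>One more factor F \<otimes> 1 + 1 \<otimes> F: each sum raises the exponent on one side,
  and Pascal's rule merges them.\<close>

lemma binomial_tensor_Suc:
  "binomial_tensor F (Suc k) \<omega> \<eta> =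
     (\<Sum>i\<le>length \<omega>. F (take i \<omega>) * binomial_tensor F k (drop i \<omega>) \<eta>) +
     (\<Sum>j\<le>length \<eta>. F (take j \<eta>) * binomial_tensor F k \<omega> (drop j \<eta>))"
proof -
  let ?a = "\<lambda>i. conv_power F i \<omega>" and ?b = "\<lambda>i. conv_power F i \<eta>"
  have 1: "(\<Sum>i\<le>length \<omega>. F (take i \<omega>) * binomial_tensor F k (drop i \<omega>) \<eta>)
      = (\<Sum>i\<le>k. of_nat (k choose i) * (?a (Suc i) * ?b (k - i)))"
    unfolding binomial_tensor_def sum_distrib_left conv_power.simps conv_def sum_distrib_right
    by (subst sum.swap) (simp add: mult_ac)
  have 2: "(\<Sum>j\<le>length \<eta>. F (take j \<eta>) * binomial_tensor F k \<omega> (drop j \<eta>))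
      = (\<Sum>i\<le>k. of_nat (k choose i) * (?a i * ?b (Suc (k - i))))"
    unfolding binomial_tensor_def sum_distrib_left conv_power.simps conv_def sum_distrib_right
    by (subst sum.swap) (simp add: mult_ac)
  \<comment> \<open>The extra summand \<open>i = Suc k\<close> vanishes with its binomial
    coefficient; it gives the sum the range required by Pascal's rule.\<close>
  have 3: "(\<Sum>i\<le>k. of_nat (k choose i) * (?a i * ?b (Suc (k - i))))
      = (\<Sum>i\<le>Suc k. of_nat (k choose i) * (?a i * ?b (Suc k - i)))"
    by (simp add: Suc_diff_le binomial_eq_0)
  show ?thesis
    unfolding 1 2 3
    by (simp add: binomial_tensor_def sum.atMost_Suc_shift sum.distrib algebra_simps binomial_eq_0 del: sum.atMost_Suc)
qed

context quasi_shuffle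
begin

lemma qsh_conv_power_Suc:
  assumes "\<And>i j. i \<le> length \<omega> \<Longrightarrow> j \<le> length \<eta> \<Longrightarrow>
     qsh F (take i \<omega>) (take j \<eta>) * qsh (conv_power F k) (drop i \<omega>) (drop j \<eta>) =
     (F (take i \<omega>) * conv_one (take j \<eta>) + conv_one (take i \<omega>) * F (take j \<eta>)) *
       binomial_tensor F k (drop i \<omega>) (drop j \<eta>)"
  shows "qsh (conv_power F (Suc k)) \<omega> \<eta> = binomial_tensor F (Suc k) \<omega> \<eta>"
proof -
  have "qsh (conv_power F (Suc k)) \<omega> \<eta> =
    (\<Sum>i\<le>length \<omega>. \<Sum>j\<le>length \<eta>.
      (F (take i \<omega>) * conv_one (take j \<eta>) + conv_one (take i \<omega>) * F (take j \<eta>)) *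
       binomial_tensor F k (drop i \<omega>) (drop j \<eta>))"
    using assms by (simp add: qsh_conv conv2_def)
  also have "\<dots> = (\<Sum>i\<le>length \<omega>. F (take i \<omega>) *
        (\<Sum>j\<le>length \<eta>. conv_one (take j \<eta>) * binomial_tensor F k (drop i \<omega>) (drop j \<eta>))) +
      (\<Sum>i\<le>length \<omega>. conv_one (take i \<omega>) *
        (\<Sum>j\<le>length \<eta>. F (take j \<eta>) * binomial_tensor F k (drop i \<omega>) (drop j \<eta>)))"
    by (simp add: sum.distrib sum_distrib_left algebra_simps)
  also have "\<dots> = binomial_tensor F (Suc k) \<omega> \<eta>"
    unfolding conv_one_left binomial_tensor_Suc
    using conv_one_left[where h = "\<lambda>\<omega>. \<Sum>j\<le>length \<eta>. F (take j \<eta>) * binomial_tensor F k \<omega> (drop j \<eta>)" and \<alpha> = \<omega>]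
    by simp
  finally show ?thesis .
qed

lemma qsh_primitive:
  assumes "F [] = 0" and "\<omega> \<noteq> [] \<Longrightarrow> \<eta> \<noteq> [] \<Longrightarrow> qsh F \<omega> \<eta> = 0"
  shows "qsh F \<omega> \<eta> = F \<omega> * conv_one \<eta> + conv_one \<omega> * F \<eta>"
  using assms by (cases "\<omega> = []"; cases "\<eta> = []") (simp_all add: conv_one_def)

text \<open>In a power, the value \<open>qsh F \<omega> \<eta>\<close> at the full pair occurs only
  next to the preceding power at empty words, which is 0 unless the exponent is 1. So control of
  \<open>F\<close> below total length \<open>n\<close> yields the formula at \<open>n\<close> itself
  for all other exponents.\<close>

lemma qsh_conv_power:
  assumes F0: "F [] = 0"
    and take: "\<And>\<omega> \<eta> i j. Q \<omega> \<eta> \<Longrightarrow> Q (take i \<omega>) (take j \<eta>)"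
    and drop: "\<And>\<omega> \<eta> i j. Q \<omega> \<eta> \<Longrightarrow> Q (drop i \<omega>) (drop j \<eta>)"
    and F: "\<And>\<omega> \<eta>. Q \<omega> \<eta> \<Longrightarrow> \<omega> \<noteq> [] \<Longrightarrow> \<eta> \<noteq> [] \<Longrightarrow> length \<omega> + length \<eta> < n \<Longrightarrow> qsh F \<omega> \<eta> = 0"
    and "Q \<omega> \<eta>" "length \<omega> + length \<eta> < n \<or> length \<omega> + length \<eta> = n \<and> k \<noteq> 1"
  shows "qsh (conv_power F k) \<omega> \<eta> = binomial_tensor F k \<omega> \<eta>"
  using assms(5,6)
proof (induction k arbitrary: \<omega> \<eta>)
  case 0
  then show ?case by (simp add: qsh_conv_one binomial_tensor_def)
next
  case (Suc k)
  show ?case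
  proof (rule qsh_conv_power_Suc, goal_cases)
    case (1 i j)
    \<comment> \<open>The exponent is \<open>Suc k\<close>. With nothing on the left,
      \<open>F [] = 0\<close> decides; with nothing on the right, the positive power
      \<open>k\<close> at the empty word. All other cuts have both parts below \<open>n\<close>; for
      \<open>k = 0\<close> the total length is below \<open>n\<close> already.\<close>
    consider "k \<noteq> 0" "i = 0" "j = 0" | "k \<noteq> 0" "i = length \<omega>" "j = length \<eta>"
      | "length (take i \<omega>) + length (take j \<eta>) < n" "length (drop i \<omega>) + length (drop j \<eta>) < n"
      using Suc.prems 1 by (auto, linarith+)
    then show ?case
    proof cases
      case 1
      then show ?thesis using F0 by simp
    next
      case 2
      have "conv_power F i [] * conv_power F (k - i) [] = 0" if "i \<le> k" for i
        using conv_power_eq_0[of F, OF F0] 2 that by (cases "i = 0") simp_all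
      moreover have "conv_power F k [] = 0"
        using conv_power_eq_0[of F, OF F0] 2 by simp
      ultimately show ?thesis using 2 by (simp add: binomial_tensor_def)
    next
      case 3
      have "qsh (conv_power F k) (drop i \<omega>) (drop j \<eta>) = binomial_tensor F k (drop i \<omega>) (drop j \<eta>)"
        using 3 Suc.prems drop by (intro Suc.IH) auto
      moreover have "qsh F (take i \<omega>) (take j \<eta>) =
          F (take i \<omega>) * conv_one (take j \<eta>) + conv_one (take i \<omega>) * F (take j \<eta>)"
        using 3 Suc.prems take by (intro qsh_primitive F0 F) auto
      ultimately show ?thesis by simp
    qed
  qed
qed

end

section \<open>Exponentials of functionals\<close>

text \<open>Truncation at the length of the word loses nothing when \<open>F [] = 0\<close>. The
  parameter \<open>c\<close> stands for the sequence 1/k!.\<close>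

definition conv_exp :: "(nat \<Rightarrow> 'k::comm_ring_1) \<Rightarrow> ('a list \<Rightarrow> 'k) \<Rightarrow> 'a list \<Rightarrow> 'k" where
  "conv_exp c F \<alpha> = (\<Sum>k\<le>length \<alpha>. c k * conv_power F k \<alpha>)"

lemma conv_exp_atMost:
  assumes "F [] = 0" "length \<alpha> \<le> n"
  shows "conv_exp c F \<alpha> = (\<Sum>k\<le>n. c k * conv_power F k \<alpha>)"
  unfolding conv_exp_def
  by (rule sum.mono_neutral_left) (use assms in \<open>simp_all add: conv_power_eq_0\<close>)

text \<open>This is exp(x + y) = exp(x) exp(y) for the commuting terms F \<otimes> 1 and 1 \<otimes>
  F, as a Cauchy product.\<close>

lemma sum_binomial_tensor:
  assumes F0: "F [] = 0" and c: "\<And>i k. i \<le> k \<Longrightarrow> of_nat (k choose i) * c k = c i * c (k - i)"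
  shows "(\<Sum>k\<le>length \<omega> + length \<eta>. c k * binomial_tensor F k \<omega> \<eta>) = conv_exp c F \<omega> * conv_exp c F \<eta>"
proof -
  let ?n = "length \<omega> + length \<eta>"
  let ?a = "\<lambda>i. c i * conv_power F i \<omega>" and ?b = "\<lambda>i. c i * conv_power F i \<eta>"
  have "(\<Sum>k\<le>?n. c k * binomial_tensor F k \<omega> \<eta>) = (\<Sum>k\<le>?n. \<Sum>i\<le>k. ?a i * ?b (k - i))"
    unfolding binomial_tensor_def sum_distrib_left
  proof (intro sum.cong refl)
    fix k i :: nat assume "i \<in> {..k}"
    then have "(of_nat (k choose i) * c k) * (conv_power F i \<omega> * conv_power F (k - i) \<eta>) =
        c i * c (k - i) * (conv_power F i \<omega> * conv_power F (k - i) \<eta>)"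
      by (simp only: c atMost_iff)
    then show "c k * (of_nat (k choose i) * (conv_power F i \<omega> * conv_power F (k - i) \<eta>)) =
        ?a i * ?b (k - i)" by (simp only: mult_ac)
  qed
  also have "\<dots> = (\<Sum>(i, j)\<in>{(i, j). i + j \<le> ?n}. ?a i * ?b j)"
    by (subst sum.triangle_reindex_eq) simp
  \<comment> \<open>From the triangle to the square: beyond the triangle one exponent exceeds the
    length of its word, so that power vanishes.\<close>
  also have "\<dots> = (\<Sum>(i, j)\<in>{..?n} \<times> {..?n}. ?a i * ?b j)"
  proof (rule sum.mono_neutral_left)
    show "\<forall>i\<in>{..?n} \<times> {..?n} - {(i, j). i + j \<le> ?n}. (case i of (i, j) \<Rightarrow> ?a i * ?b j) = 0"
    proof
      fix x assume "x \<in> {..?n} \<times> {..?n} - {(i, j). i + j \<le> ?n}"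
      then obtain i j where x: "x = (i, j)" and "\<not> i + j \<le> ?n" by (cases x) auto
      then have "length \<omega> < i \<or> length \<eta> < j" by linarith
      then show "(case x of (i, j) \<Rightarrow> ?a i * ?b j) = 0"
        using conv_power_eq_0[of F, OF F0] by (auto simp: x)
    qed
  qed auto
  also have "\<dots> = conv_exp c F \<omega> * conv_exp c F \<eta>"
    by (simp add: conv_exp_atMost[of F _ ?n, OF F0] sum_product sum.cartesian_product)
  finally show ?thesis .
qed

context quasi_shuffle
begin

text \<open>
  All summands of \<open>qsh (conv_exp c F)\<close> but the linear one involve \<open>qsh F\<close> only on pairs of smaller
  total length. Hence this one identity shows both that exponentials of primitive functionals are
  multiplicative and, by induction on the total length, that their logarithms are primitive.
\<close>

lemma qsh_conv_exp:
  assumes F0: "F [] = 0" and c: "c 0 = 1" "c 1 = 1"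
      "\<And>i k. i \<le> k \<Longrightarrow> of_nat (k choose i) * c k = c i * c (k - i)"
    and take: "\<And>\<omega> \<eta> i j. Q \<omega> \<eta> \<Longrightarrow> Q (take i \<omega>) (take j \<eta>)"
    and drop: "\<And>\<omega> \<eta> i j. Q \<omega> \<eta> \<Longrightarrow> Q (drop i \<omega>) (drop j \<eta>)"
    and F: "\<And>\<omega> \<eta>. Q \<omega> \<eta> \<Longrightarrow> \<omega> \<noteq> [] \<Longrightarrow> \<eta> \<noteq> [] \<Longrightarrow> length \<omega> + length \<eta> < n \<Longrightarrow> qsh F \<omega> \<eta> = 0"
    and Q: "Q \<omega> \<eta>" and n: "length \<omega> + length \<eta> = n" and ne: "\<omega> \<noteq> []" "\<eta> \<noteq> []"
  shows "qsh (conv_exp c F) \<omega> \<eta> = conv_exp c F \<omega> * conv_exp c F \<eta> + qsh F \<omega> \<eta>"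
proof -
  \<comment> \<open>The words of the product have various lengths; the common truncation at
    \<open>n\<close> makes linearity of \<open>qsh\<close> applicable.\<close>
  have "qsh (conv_exp c F) \<omega> \<eta> = qsh (\<lambda>\<alpha>. \<Sum>k\<le>n. c k * conv_power F k \<alpha>) \<omega> \<eta>"
    by (rule qsh_cong) (use length_qsh_words n in \<open>auto intro!: conv_exp_atMost F0\<close>)
  also have "\<dots> = (\<Sum>k\<le>n. c k * qsh (conv_power F k) \<omega> \<eta>)"
    by (simp add: qsh_sum qsh_mult)
  \<comment> \<open>The summand \<open>k = 1\<close> is the one not covered by
    \<open>qsh_conv_power\<close>. Its binomial tensor is 0 because both words are nonempty, so
    \<open>qsh F \<omega> \<eta>\<close> appears as the correction.\<close>
  also have "\<dots> = (\<Sum>k\<le>n. c k * binomial_tensor F k \<omega> \<eta> + (if k = 1 then qsh F \<omega> \<eta> else 0))"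
  proof (rule sum.cong, rule refl)
    fix k
    show "c k * qsh (conv_power F k) \<omega> \<eta> =
        c k * binomial_tensor F k \<omega> \<eta> + (if k = 1 then qsh F \<omega> \<eta> else 0)"
    proof (cases "k = 1")
      case True
      have "conv_power F 1 = F"
      proof
        fix \<alpha>
        have "conv F conv_one \<alpha> = (\<Sum>i\<in>{length \<alpha>}. F (take i \<alpha>))"
          unfolding conv_def
          by (rule sum.mono_neutral_cong_right) (auto simp: conv_one_def)
        then show "conv_power F 1 \<alpha> = F \<alpha>" by simp
      qed
      then show ?thesis using True c ne by (simp add: binomial_tensor_def conv_one_def)
    next
      case False
      then show ?thesis
        using qsh_conv_power[where Q=Q and n=n, OF F0 take drop F Q] n by simp
    qed
  qed
  also have "\<dots> = conv_exp c F \<omega> * conv_exp c F \<eta> + qsh F \<omega> \<eta>"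
  proof -
    have "n \<ge> 1" using n ne by (cases \<omega>) auto
    then show ?thesis
      using sum_binomial_tensor[of F c \<omega> \<eta>] F0 c n by (simp add: sum.distrib)
  qed
  finally show ?thesis .
qed

theorem qsh_conv_exp_iff:
  assumes F0: "F [] = 0" and c: "c 0 = 1" "c 1 = 1"
      "\<And>i k. i \<le> k \<Longrightarrow> of_nat (k choose i) * c k = c i * c (k - i)"
    and take: "\<And>\<omega> \<eta> i j. Q \<omega> \<eta> \<Longrightarrow> Q (take i \<omega>) (take j \<eta>)"
    and drop: "\<And>\<omega> \<eta> i j. Q \<omega> \<eta> \<Longrightarrow> Q (drop i \<omega>) (drop j \<eta>)"
  shows "(\<forall>\<omega> \<eta>. Q \<omega> \<eta> \<longrightarrow> \<omega> \<noteq> [] \<longrightarrow> \<eta> \<noteq> [] \<longrightarrow> qsh (conv_exp c F) \<omega> \<eta> = conv_exp c F \<omega> * conv_exp c F \<eta>)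
     \<longleftrightarrow> (\<forall>\<omega> \<eta>. Q \<omega> \<eta> \<longrightarrow> \<omega> \<noteq> [] \<longrightarrow> \<eta> \<noteq> [] \<longrightarrow> qsh F \<omega> \<eta> = 0)"
    (is "?L = ?R")
proof
  note * = qsh_conv_exp[where F=F and c=c and Q=Q, OF F0 c take drop _ _ refl]
  show ?L if ?R using that by (simp add: *)
  show ?R if L: ?L
  proof (intro allI)
    fix \<omega> \<eta>
    show "Q \<omega> \<eta> \<longrightarrow> \<omega> \<noteq> [] \<longrightarrow> \<eta> \<noteq> [] \<longrightarrow> qsh F \<omega> \<eta> = 0"
    proof (induction "length \<omega> + length \<eta>" arbitrary: \<omega> \<eta> rule: less_induct)
      case less
      \<comment> \<open>Shorter pairs satisfy the claim, so the identity holds here; compared with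
        multiplicativity it leaves \<open>qsh F \<omega> \<eta> = 0\<close>.\<close>
      then show ?case using *[of \<omega> \<eta>] L by (metis add_cancel_left_right)
    qed
  qed
qed

end

section \<open>Substitution of variables in rational functions\<close>

lemma rat_const_0 [simp]: "rat_const 0 = 0"
  and rat_const_1 [simp]: "rat_const 1 = 1"
  by (simp_all add: rat_const_def fract_collapse)

lemma rat_const_add: "rat_const (a + b) = rat_const a + rat_const b"
  by (simp add: rat_const_def single_add)

lemma rat_const_mult: "rat_const (a * b) = rat_const a * rat_const b"
  by (simp add: rat_const_def mult_single)

lemma rat_const_of_nat: "rat_const (of_nat n) = of_nat n"
  by (induction n) (simp_all add: rat_const_add)

definition monom_eval :: "(nat \<Rightarrow> ratfun) \<Rightarrow> (nat \<Rightarrow>\<^sub>0 nat) \<Rightarrow> ratfun" where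
  "monom_eval w t = (\<Prod>i\<in>Poly_Mapping.keys t. w i ^ Poly_Mapping.lookup t i)"

lemma monom_eval_superset:
  "finite I \<Longrightarrow> Poly_Mapping.keys t \<subseteq> I \<Longrightarrow> monom_eval w t = (\<Prod>i\<in>I. w i ^ Poly_Mapping.lookup t i)"
  unfolding monom_eval_def by (rule prod.mono_neutral_left) (auto simp: in_keys_iff)

lemma monom_eval_0 [simp]: "monom_eval w 0 = 1"
  by (simp add: monom_eval_def)

lemma monom_eval_add: "monom_eval w (s + t) = monom_eval w s * monom_eval w t"
proof -
  let ?I = "Poly_Mapping.keys s \<union> Poly_Mapping.keys t"
  have "Poly_Mapping.keys (s + t) \<subseteq> ?I" by (rule keys_add)
  then show ?thesis
    by (simp add: monom_eval_superset[of ?I] lookup_add power_add prod.distrib)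
qed

lemma mpoly_eval_superset:
  assumes "finite T" "Poly_Mapping.keys p \<subseteq> T"
  shows "mpoly_eval w p = (\<Sum>t\<in>T. rat_const (Poly_Mapping.lookup p t) * monom_eval w t)"
  unfolding mpoly_eval_def monom_eval_def[symmetric]
  by (rule sum.mono_neutral_left) (use assms in \<open>auto simp: in_keys_iff\<close>)

lemma mpoly_eval_single [simp]: "mpoly_eval w (Poly_Mapping.single t c) = rat_const c * monom_eval w t"
  by (subst mpoly_eval_superset[of "{t}"]) simp_all

lemma mpoly_eval_0 [simp]: "mpoly_eval w 0 = 0"
  by (simp add: mpoly_eval_def)

lemma mpoly_eval_1 [simp]: "mpoly_eval w 1 = 1"
  using mpoly_eval_single[of w 0 1] by simp

lemma mpoly_eval_add: "mpoly_eval w (p + q) = mpoly_eval w p + mpoly_eval w q"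
proof -
  let ?T = "Poly_Mapping.keys p \<union> Poly_Mapping.keys q"
  have "Poly_Mapping.keys (p + q) \<subseteq> ?T" by (rule keys_add)
  then show ?thesis
    by (simp add: mpoly_eval_superset[of ?T] lookup_add rat_const_add sum.distrib algebra_simps)
qed

lemma mpoly_eval_sum: "mpoly_eval w (\<Sum>x\<in>X. f x) = (\<Sum>x\<in>X. mpoly_eval w (f x))"
  by (induction X rule: infinite_finite_induct) (simp_all add: mpoly_eval_add)

lemma poly_mapping_sum_single:
  "p = (\<Sum>t\<in>Poly_Mapping.keys p. Poly_Mapping.single t (Poly_Mapping.lookup p t))"
  by (rule poly_mapping_eqI) (simp add: lookup_sum lookup_single when_def in_keys_iff)

lemma mpoly_eval_mult: "mpoly_eval w (p * q) = mpoly_eval w p * mpoly_eval w q"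
proof -
  let ?P = "Poly_Mapping.keys p" and ?Q = "Poly_Mapping.keys q"
  let ?p = "Poly_Mapping.lookup p" and ?q = "Poly_Mapping.lookup q"
  have "p * q = (\<Sum>s\<in>?P. \<Sum>t\<in>?Q. Poly_Mapping.single (s + t) (?p s * ?q t))"
    by (subst poly_mapping_sum_single[of p], subst poly_mapping_sum_single[of q])
       (simp add: sum_product mult_single)
  then have "mpoly_eval w (p * q) =
      (\<Sum>s\<in>?P. \<Sum>t\<in>?Q. (rat_const (?p s) * monom_eval w s) * (rat_const (?q t) * monom_eval w t))"
    by (simp add: mpoly_eval_sum rat_const_mult monom_eval_add mult_ac)
  also have "\<dots> = mpoly_eval w p * mpoly_eval w q"
    by (simp add: sum_product mpoly_eval_superset[of ?P] mpoly_eval_superset[of ?Q])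
  finally show ?thesis .
qed

text \<open>Two representing fractions satisfy \<open>p * q' = p' * q\<close>; evaluation is
  multiplicative, so the quotients of the values agree and the definite description is
  determined.\<close>

lemma ratfun_subst_Fract:
  assumes "mpoly_eval w q \<noteq> 0"
  shows "ratfun_subst w (Fraction_Field.Fract p q) = mpoly_eval w p / mpoly_eval w q"
  unfolding ratfun_subst_def
proof (rule the_equality)
  fix y
  assume "\<exists>p' q'. Fraction_Field.Fract p q = Fraction_Field.Fract p' q' \<and>
    mpoly_eval w q' \<noteq> 0 \<and> y = mpoly_eval w p' / mpoly_eval w q'"
  then obtain p' q' where eq: "Fraction_Field.Fract p q = Fraction_Field.Fract p' q'"
    and q': "mpoly_eval w q' \<noteq> 0" and y: "y = mpoly_eval w p' / mpoly_eval w q'" by blast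
  have "q \<noteq> 0" "q' \<noteq> 0" using assms q' by auto
  then have "p * q' = p' * q" using eq by (simp add: eq_fract)
  then have "mpoly_eval w p * mpoly_eval w q' = mpoly_eval w p' * mpoly_eval w q"
    by (metis mpoly_eval_mult)
  then show "y = mpoly_eval w p / mpoly_eval w q"
    using assms q' y by (simp add: frac_eq_eq)
qed (use assms in blast)

lemma mpoly_eval_cong:
  assumes "\<And>i. i \<in> mpoly_vars p \<Longrightarrow> w i = w' i"
  shows "mpoly_eval w p = mpoly_eval w' p"
proof -
  have "w i = w' i" if "t \<in> Poly_Mapping.keys p" "i \<in> Poly_Mapping.keys t" for t i
    using that by (intro assms) (auto simp: mpoly_vars_def)
  then show ?thesis by (simp add: mpoly_eval_def)
qed

section \<open>Injective renamings of variables\<close>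

definition rename_monom :: "(nat \<Rightarrow> nat) \<Rightarrow> (nat \<Rightarrow>\<^sub>0 nat) \<Rightarrow> (nat \<Rightarrow>\<^sub>0 nat)" where
  "rename_monom \<pi> t =
     (\<Sum>i\<in>Poly_Mapping.keys t. Poly_Mapping.single (\<pi> i) (Poly_Mapping.lookup t i))"

lemma inj_rename_monom:
  assumes "inj \<pi>"
  shows "inj (rename_monom \<pi>)"
proof (rule injI, rule poly_mapping_eqI)
  have *: "Poly_Mapping.lookup (rename_monom \<pi> t) (\<pi> j) = Poly_Mapping.lookup t j" for t j
    using assms
    by (simp add: rename_monom_def lookup_sum lookup_single when_def inj_eq in_keys_iff)
  fix s t j
  assume "rename_monom \<pi> s = rename_monom \<pi> t"
  then show "Poly_Mapping.lookup s j = Poly_Mapping.lookup t j" by (metis *)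
qed

lemma ratfun_var_power:
  "ratfun_var i ^ n = Fraction_Field.Fract (Poly_Mapping.single (Poly_Mapping.single i n) 1) 1"
proof (induction n)
  case (Suc n)
  have "Poly_Mapping.single i (1::nat) + Poly_Mapping.single i n = Poly_Mapping.single i (Suc n)"
    by (simp flip: single_add)
  then show ?case unfolding power_Suc Suc.IH by (simp add: ratfun_var_def mult_single)
qed (simp add: fract_collapse)

lemma monom_eval_ratfun_var:
  "monom_eval (\<lambda>i. ratfun_var (\<pi> i)) t =
     Fraction_Field.Fract (Poly_Mapping.single (rename_monom \<pi> t) 1) 1"
proof -
  have "(\<Prod>i\<in>I. ratfun_var (\<pi> i) ^ f i) = Fraction_Field.Fract
      (Poly_Mapping.single (\<Sum>i\<in>I. Poly_Mapping.single (\<pi> i) (f i)) 1) 1" for I f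
    by (induction I rule: infinite_finite_induct)
       (simp_all add: ratfun_var_power mult_single fract_collapse)
  then show ?thesis by (simp add: monom_eval_def rename_monom_def)
qed

lemma mpoly_eval_ratfun_var:
  "mpoly_eval (\<lambda>i. ratfun_var (\<pi> i)) p = Fraction_Field.Fract
     (\<Sum>t\<in>Poly_Mapping.keys p. Poly_Mapping.single (rename_monom \<pi> t) (Poly_Mapping.lookup p t)) 1"
proof -
  have *: "(\<Sum>t\<in>T. Fraction_Field.Fract (f t) 1) = Fraction_Field.Fract (\<Sum>t\<in>T. f t) 1"
    for T and f :: "_ \<Rightarrow> rat_mpoly"
    by (induction T rule: infinite_finite_induct) (simp_all add: fract_collapse)
  show ?thesis
    by (simp add: mpoly_eval_def monom_eval_def[symmetric] monom_eval_ratfun_var rat_const_def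
        mult_single *)
qed

text \<open>Distinct monomials remain distinct under an injective renaming, so nothing cancels and
  denominators survive.\<close>

lemma mpoly_eval_ratfun_var_neq_0:
  assumes "inj \<pi>" "p \<noteq> 0"
  shows "mpoly_eval (\<lambda>i. ratfun_var (\<pi> i)) p \<noteq> 0"
proof -
  obtain t where t: "t \<in> Poly_Mapping.keys p" using assms by fastforce
  let ?q = "\<Sum>t\<in>Poly_Mapping.keys p. Poly_Mapping.single (rename_monom \<pi> t) (Poly_Mapping.lookup p t)"
  have "Poly_Mapping.lookup ?q (rename_monom \<pi> t) = Poly_Mapping.lookup p t"
    using t by (simp add: lookup_sum lookup_single when_def inj_eq[OF inj_rename_monom[OF assms(1)]])
  then have "?q \<noteq> 0" using t by (auto simp: in_keys_iff)
  then show ?thesis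
    unfolding mpoly_eval_ratfun_var by (simp add: Zero_fract_def eq_fract)
qed

text \<open>For an injection of all of \<open>nat\<close> this is an endomorphism of the whole
  field, which spares conditions on the variables that occur.\<close>

definition rename :: "(nat \<Rightarrow> nat) \<Rightarrow> ratfun \<Rightarrow> ratfun" where
  "rename \<pi> = ratfun_subst (\<lambda>i. ratfun_var (\<pi> i))"

context
  fixes \<pi> :: "nat \<Rightarrow> nat"
  assumes inj: "inj \<pi>"
begin

lemma rename_Fract:
  "q \<noteq> 0 \<Longrightarrow> rename \<pi> (Fraction_Field.Fract p q) =
     mpoly_eval (\<lambda>i. ratfun_var (\<pi> i)) p / mpoly_eval (\<lambda>i. ratfun_var (\<pi> i)) q"
  unfolding rename_def by (rule ratfun_subst_Fract) (rule mpoly_eval_ratfun_var_neq_0[OF inj])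

lemma rename_0 [simp]: "rename \<pi> 0 = 0"
  using rename_Fract[of 1 0] by (simp add: fract_collapse)

lemma rename_1 [simp]: "rename \<pi> 1 = 1"
  using rename_Fract[of 1 1] by (simp add: fract_collapse)

lemma rename_rat_const [simp]: "rename \<pi> (rat_const c) = rat_const c"
  unfolding rat_const_def
  by (subst rename_Fract) (simp_all add: rat_const_def)

lemma rename_ratfun_var [simp]: "rename \<pi> (ratfun_var i) = ratfun_var (\<pi> i)"
  unfolding ratfun_var_def
  by (subst rename_Fract) (simp_all add: ratfun_var_def monom_eval_def)

lemma rename_add: "rename \<pi> (f + g) = rename \<pi> f + rename \<pi> g"
  by (cases f; cases g)
     (simp add: rename_Fract mpoly_eval_add mpoly_eval_mult mpoly_eval_ratfun_var_neq_0[OF inj] field_simps)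

lemma rename_mult: "rename \<pi> (f * g) = rename \<pi> f * rename \<pi> g"
  by (cases f; cases g) (simp add: rename_Fract mpoly_eval_mult)

lemma rename_diff: "rename \<pi> (f - g) = rename \<pi> f - rename \<pi> g"
  using rename_add[of "f - g" g] by simp

lemma rename_eq_0_iff [simp]: "rename \<pi> f = 0 \<longleftrightarrow> f = 0"
proof
  assume *: "rename \<pi> f = 0"
  show "f = 0"
  proof (rule ccontr)
    assume "f \<noteq> 0"
    then show False using rename_mult[of f "inverse f"] * by simp
  qed
qed simp

lemma rename_divide: "rename \<pi> (f / g) = rename \<pi> f / rename \<pi> g"
proof (cases "g = 0")
  case False
  then show ?thesis using rename_mult[of "f / g" g] by (simp add: field_simps)
qed simp

lemma rename_sum: "rename \<pi> (\<Sum>x\<in>X. f x) = (\<Sum>x\<in>X. rename \<pi> (f x))"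
  by (induction X rule: infinite_finite_induct) (simp_all add: rename_add)

lemma rename_power: "rename \<pi> (f ^ n) = rename \<pi> f ^ n"
  by (induction n) (simp_all add: rename_mult)

lemma rename_prod: "rename \<pi> (\<Prod>x\<in>X. f x) = (\<Prod>x\<in>X. rename \<pi> (f x))"
  by (induction X rule: infinite_finite_induct) (simp_all add: rename_mult)

lemma rename_mpoly_eval: "rename \<pi> (mpoly_eval w p) = mpoly_eval (\<lambda>i. rename \<pi> (w i)) p"
  by (simp add: mpoly_eval_def rename_sum rename_mult rename_prod rename_power)

lemma rename_rename:
  assumes "inj \<rho>"
  shows "rename \<pi> (rename \<rho> f) = rename (\<pi> \<circ> \<rho>) f"
proof (cases f)
  case (Fract p q)
  have "rename \<pi> (rename \<rho> f) = rename \<pi>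
      (mpoly_eval (\<lambda>i. ratfun_var (\<rho> i)) p / mpoly_eval (\<lambda>i. ratfun_var (\<rho> i)) q)"
    using Fract assms unfolding rename_def
    by (simp add: ratfun_subst_Fract mpoly_eval_ratfun_var_neq_0)
  also have "\<dots> = mpoly_eval (\<lambda>i. ratfun_var (\<pi> (\<rho> i))) p / mpoly_eval (\<lambda>i. ratfun_var (\<pi> (\<rho> i))) q"
    by (simp add: rename_divide rename_mpoly_eval)
  also have "\<dots> = rename (\<pi> \<circ> \<rho>) f"
    using Fract assms inj unfolding rename_def
    by (simp add: ratfun_subst_Fract mpoly_eval_ratfun_var_neq_0[OF inj_compose[OF inj assms], unfolded comp_def])
  finally show ?thesis .
qed

end

lemma mpoly_eval_ratfun_var_id: "mpoly_eval ratfun_var p = Fraction_Field.Fract p 1"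
proof -
  have "rename_monom id t = t" for t
    unfolding rename_monom_def id_def by (rule poly_mapping_sum_single[symmetric])
  then show ?thesis
    using mpoly_eval_ratfun_var[of id p] poly_mapping_sum_single[of p] by simp
qed

lemma rename_id [simp]: "rename id f = f"
proof (cases f)
  case (Fract p q)
  then show ?thesis using rename_Fract[of id q p] by (simp add: mpoly_eval_ratfun_var_id)
qed

section \<open>Moulds as functionals on words\<close>

lemma mpoly_vars_0 [simp]: "mpoly_vars 0 = {}"
  and mpoly_vars_1 [simp]: "mpoly_vars 1 = {}"
  by (simp_all add: mpoly_vars_def)

lemma mpoly_vars_single: "mpoly_vars (Poly_Mapping.single t c) \<subseteq> Poly_Mapping.keys t"
  by (simp add: mpoly_vars_def)

lemma mpoly_vars_add: "mpoly_vars (p + q) \<subseteq> mpoly_vars p \<union> mpoly_vars q"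
  using keys_add[of p q] unfolding mpoly_vars_def by blast

lemma mpoly_vars_minus [simp]: "mpoly_vars (- p) = mpoly_vars p"
  by (simp add: mpoly_vars_def in_keys_iff set_eq_iff)

lemma mpoly_vars_mult: "mpoly_vars (p * q) \<subseteq> mpoly_vars p \<union> mpoly_vars q"
proof
  fix i assume "i \<in> mpoly_vars (p * q)"
  then obtain s t where st: "s \<in> Poly_Mapping.keys p" "t \<in> Poly_Mapping.keys q"
    and "i \<in> Poly_Mapping.keys (s + t)"
    using keys_mult[of p q] by (auto simp: mpoly_vars_def)
  then have "i \<in> Poly_Mapping.keys s \<union> Poly_Mapping.keys t" using keys_add[of s t] by blast
  with st show "i \<in> mpoly_vars p \<union> mpoly_vars q" by (auto simp: mpoly_vars_def)
qed

text \<open>A fraction with denominator 0 is 0; admitting it spares a case distinction for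
  division.\<close>

lemma Fract_in_ratfuns:
  assumes "mpoly_vars p \<subseteq> {..<m}" "mpoly_vars q \<subseteq> {..<m}"
  shows "Fraction_Field.Fract p q \<in> ratfuns m"
proof (cases "q = 0")
  case True
  then have "Fraction_Field.Fract p q = Fraction_Field.Fract 0 1" by (simp add: fract_collapse)
  then show ?thesis unfolding ratfuns_def by fastforce
qed (use assms in \<open>auto simp: ratfuns_def\<close>)

lemma ratfuns_cases:
  assumes "f \<in> ratfuns m"
  obtains p q where "f = Fraction_Field.Fract p q" "q \<noteq> 0"
    "mpoly_vars p \<subseteq> {..<m}" "mpoly_vars q \<subseteq> {..<m}"
  using assms by (auto simp: ratfuns_def)

lemma ratfuns_0 [simp]: "0 \<in> ratfuns m"
  using Fract_in_ratfuns[of 0 m 1] by (simp add: fract_collapse)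

lemma ratfuns_1 [simp]: "1 \<in> ratfuns m"
  using Fract_in_ratfuns[of 1 m 1] by (simp add: fract_collapse)

lemma ratfuns_rat_const [simp]: "rat_const c \<in> ratfuns m"
  unfolding rat_const_def using mpoly_vars_single[of 0 c] by (intro Fract_in_ratfuns) auto

lemma ratfuns_ratfun_var: "i < m \<Longrightarrow> ratfun_var i \<in> ratfuns m"
  unfolding ratfun_var_def using mpoly_vars_single[of "Poly_Mapping.single i 1" 1]
  by (intro Fract_in_ratfuns) auto

lemma ratfuns_mult: "f \<in> ratfuns m \<Longrightarrow> g \<in> ratfuns m \<Longrightarrow> f * g \<in> ratfuns m"
  by (elim ratfuns_cases) (use mpoly_vars_mult in \<open>fastforce intro!: Fract_in_ratfuns\<close>)

lemma ratfuns_add: "f \<in> ratfuns m \<Longrightarrow> g \<in> ratfuns m \<Longrightarrow> f + g \<in> ratfuns m"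
  by (elim ratfuns_cases, hypsubst, subst add_fract, assumption, assumption, rule Fract_in_ratfuns)
     (use mpoly_vars_mult mpoly_vars_add in blast)+

lemma ratfuns_minus: "f \<in> ratfuns m \<Longrightarrow> - f \<in> ratfuns m"
  by (elim ratfuns_cases) (auto intro!: Fract_in_ratfuns)

lemma ratfuns_diff: "f \<in> ratfuns m \<Longrightarrow> g \<in> ratfuns m \<Longrightarrow> f - g \<in> ratfuns m"
  using ratfuns_add[of f m "- g"] ratfuns_minus by simp

lemma ratfuns_divide: "f \<in> ratfuns m \<Longrightarrow> g \<in> ratfuns m \<Longrightarrow> f / g \<in> ratfuns m"
  by (elim ratfuns_cases) (use mpoly_vars_mult in \<open>fastforce intro!: Fract_in_ratfuns\<close>)

lemma ratfuns_sum: "(\<And>x. x \<in> X \<Longrightarrow> f x \<in> ratfuns m) \<Longrightarrow> (\<Sum>x\<in>X. f x) \<in> ratfuns m"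
  by (induction X rule: infinite_finite_induct) (simp_all add: ratfuns_add)

lemma ratfuns_prod: "(\<And>x. x \<in> X \<Longrightarrow> f x \<in> ratfuns m) \<Longrightarrow> (\<Prod>x\<in>X. f x) \<in> ratfuns m"
  by (induction X rule: infinite_finite_induct) (simp_all add: ratfuns_mult)

lemma ratfuns_power: "f \<in> ratfuns m \<Longrightarrow> f ^ n \<in> ratfuns m"
  by (induction n) (simp_all add: ratfuns_mult)

lemma ratfuns_mpoly_eval:
  assumes "\<And>i. i \<in> mpoly_vars p \<Longrightarrow> w i \<in> ratfuns m"
  shows "mpoly_eval w p \<in> ratfuns m"
  unfolding mpoly_eval_def
  by (intro ratfuns_sum ratfuns_mult ratfuns_prod ratfuns_power assms ratfuns_rat_const)
     (auto simp: mpoly_vars_def)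

lemma ratfuns_rename:
  assumes "inj \<pi>" "f \<in> ratfuns m" "\<And>i. i < m \<Longrightarrow> \<pi> i < n"
  shows "rename \<pi> f \<in> ratfuns n"
  using assms(2)
  by (elim ratfuns_cases)
     (use assms in \<open>force simp: rename_Fract intro!: ratfuns_divide ratfuns_mpoly_eval ratfuns_ratfun_var\<close>)

lemma ratfun_subst_0 [simp]: "ratfun_subst w 0 = 0"
  using ratfun_subst_Fract[of w 1 0] by (simp add: fract_collapse)

lemma lin_form_lin_var [simp]: "lin_form (lin_var i) = ratfun_var i"
  by (simp add: lin_form_def)

text \<open>The component involves only the first \<open>length is\<close> variables, so list
  entries beyond the end and the values of \<open>\<pi>\<close> there have no influence.\<close>

lemma mould_at_eq_rename:
  assumes "M \<sigma>s \<in> ratfuns (length is)" "inj \<pi>" "\<And>j. j < length is \<Longrightarrow> \<pi> j = is ! j"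
  shows "mould_at M \<sigma>s (map lin_var is) = rename \<pi> (M \<sigma>s)"
  using assms(1)
proof (cases rule: ratfuns_cases)
  case (1 p q)
  have *: "mpoly_eval (\<lambda>i. lin_form (map lin_var is ! i)) r = mpoly_eval (\<lambda>i. ratfun_var (\<pi> i)) r"
    if "mpoly_vars r \<subseteq> {..<length is}" for r
    using that by (intro mpoly_eval_cong) (auto simp: assms(3))
  show ?thesis
    using 1 mpoly_eval_ratfun_var_neq_0[OF assms(2), of q]
    by (simp add: mould_at_def rename_def ratfun_subst_Fract *)
qed

lemma distinct_imp_injective_extension:
  fixes xs :: "nat list"
  assumes "distinct xs"
  obtains \<pi> where "inj \<pi>" "\<And>j. j < length xs \<Longrightarrow> \<pi> j = xs ! j"
proof
  \<comment> \<open>\<open>sum_list xs\<close> bounds every entry, so the values chosen beyond the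
    list are new and pairwise distinct.\<close>
  let ?\<pi> = "\<lambda>j. if j < length xs then xs ! j else Suc (j + sum_list xs)"
  have "xs ! j \<le> sum_list xs" if "j < length xs" for j
    using that by (simp add: member_le_sum_list)
  then show "inj ?\<pi>"
    using assms by (fastforce simp: inj_def nth_eq_iff_index_eq dest: leD split: if_splits)
qed auto

lemma BIMU_iff: "M \<in> BIMU \<Gamma> \<longleftrightarrow>
    (\<forall>\<sigma>s. M \<sigma>s \<in> ratfuns (length \<sigma>s) \<and> (\<not> set \<sigma>s \<subseteq> carrier \<Gamma> \<longrightarrow> M \<sigma>s = 0))"
  unfolding BIMU_def by (auto intro: ratfuns_0) (metis ratfuns_0)

text \<open>
  Words whose letters carry variables are represented by lists of pairs of a group element and the
  index of a variable; \<open>mould_val M \<alpha>\<close> is the value at such a word of the functional given by \<open>M\<close>.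
\<close>

definition mould_val :: "'g mould \<Rightarrow> ('g \<times> nat) list \<Rightarrow> ratfun" where
  "mould_val M \<alpha> = mould_at M (map fst \<alpha>) (map lin_var (map snd \<alpha>))"

lemma mould_val_eq_rename:
  assumes "M \<in> BIMU \<Gamma>" "inj \<pi>" "\<And>j. j < length \<alpha> \<Longrightarrow> \<pi> j = snd (\<alpha> ! j)"
  shows "mould_val M \<alpha> = rename \<pi> (M (map fst \<alpha>))"
  unfolding mould_val_def
proof (rule mould_at_eq_rename)
  show "M (map fst \<alpha>) \<in> ratfuns (length (map snd \<alpha>))"
    using assms(1) by (metis BIMU_iff length_map)
qed (use assms in auto)

text \<open>With \<open>\<rho>\<close> an injection extending the variables of
  \<open>\<alpha>\<close>, both sides are the renaming of one component along
  \<open>\<pi> \<circ> \<rho>\<close>.\<close>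

lemma mould_val_map:
  assumes M: "M \<in> BIMU \<Gamma>" and \<pi>: "inj \<pi>" and "distinct (map snd \<alpha>)"
  shows "mould_val M (map (map_prod id \<pi>) \<alpha>) = rename \<pi> (mould_val M \<alpha>)"
proof -
  obtain \<rho> where \<rho>: "inj \<rho>" "\<And>j. j < length \<alpha> \<Longrightarrow> \<rho> j = snd (\<alpha> ! j)"
    using distinct_imp_injective_extension[OF assms(3)] by auto
  have "mould_val M (map (map_prod id \<pi>) \<alpha>) = rename (\<pi> \<circ> \<rho>) (M (map fst (map (map_prod id \<pi>) \<alpha>)))"
    by (rule mould_val_eq_rename[OF M inj_compose[OF \<pi> \<rho>(1)]]) (simp add: \<rho>)
  also have "\<dots> = rename \<pi> (mould_val M \<alpha>)"
    using \<pi> \<rho> by (simp add: rename_rename mould_val_eq_rename[OF M \<rho>] comp_def)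
  finally show ?thesis .
qed

section \<open>Products and powers of moulds\<close>

lemma mould_mult_eq:
  "mould_mult A B \<sigma>s = (\<Sum>i\<le>length \<sigma>s. mould_at A (take i \<sigma>s) (map lin_var [0..<i]) *
     mould_at B (drop i \<sigma>s) (map lin_var [i..<length \<sigma>s]))"
  unfolding mould_mult_def Let_def by (intro sum.cong refl) (simp add: take_map drop_map)

lemma mould_mult_eq_val:
  "mould_mult A B \<sigma>s = conv (mould_val A) (mould_val B) (zip \<sigma>s [0..<length \<sigma>s])"
  unfolding mould_mult_eq conv_def
  by (intro sum.cong) (auto simp: mould_val_def take_zip drop_zip)

lemma mould_at_in_ratfuns:
  assumes "M \<in> BIMU \<Gamma>" "distinct is" "length is = length \<sigma>s" "\<And>i. i \<in> set is \<Longrightarrow> i < n"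
  shows "mould_at M \<sigma>s (map lin_var is) \<in> ratfuns n"
proof -
  obtain \<pi> where \<pi>: "inj \<pi>" "\<And>j. j < length is \<Longrightarrow> \<pi> j = is ! j"
    using distinct_imp_injective_extension[OF assms(2)] by auto
  have M: "M \<sigma>s \<in> ratfuns (length is)" using assms by (simp add: BIMU_iff)
  have "rename \<pi> (M \<sigma>s) \<in> ratfuns n"
    by (rule ratfuns_rename[OF \<pi>(1) M]) (simp add: \<pi> assms)
  then show ?thesis by (subst mould_at_eq_rename[where \<pi>=\<pi>]) (simp_all add: M \<pi>)
qed

lemma mould_at_0: "M \<sigma>s = 0 \<Longrightarrow> mould_at M \<sigma>s ws = 0"
  by (simp add: mould_at_def)

lemma mould_mult_BIMU:
  assumes "A \<in> BIMU \<Gamma>" "B \<in> BIMU \<Gamma>"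
  shows "mould_mult A B \<in> BIMU \<Gamma>"
  unfolding BIMU_iff
proof (intro allI conjI impI)
  fix \<sigma>s :: "'a list"
  show "mould_mult A B \<sigma>s \<in> ratfuns (length \<sigma>s)"
    unfolding mould_mult_eq
    by (intro ratfuns_sum ratfuns_mult mould_at_in_ratfuns[OF assms(1)] mould_at_in_ratfuns[OF assms(2)]) auto
  assume not: "\<not> set \<sigma>s \<subseteq> carrier \<Gamma>"
  have "A (take i \<sigma>s) = 0 \<or> B (drop i \<sigma>s) = 0" for i
  proof -
    have "\<not> set (take i \<sigma>s) \<subseteq> carrier \<Gamma> \<or> \<not> set (drop i \<sigma>s) \<subseteq> carrier \<Gamma>"
      using not by (metis append_take_drop_id set_append Un_subset_iff)
    then show ?thesis using assms by (auto simp: BIMU_iff)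
  qed
  then have "mould_at A (take i \<sigma>s) v * mould_at B (drop i \<sigma>s) w = 0" for i v w
    by (metis mould_at_0 mult_zero_left mult_zero_right)
  then show "mould_mult A B \<sigma>s = 0"
    unfolding mould_mult_eq by (intro sum.neutral ballI)
qed

lemma mould_one_BIMU: "mould_one \<in> BIMU \<Gamma>"
  by (auto simp: BIMU_iff mould_one_def)

lemma mould_power_BIMU: "A \<in> BIMU \<Gamma> \<Longrightarrow> mould_power A k \<in> BIMU \<Gamma>"
  by (induction k) (simp_all add: mould_one_BIMU mould_mult_BIMU)

text \<open>\<open>mould_mult\<close> is defined through the standard variables; the formula there
  is carried to \<open>\<alpha>\<close> by renaming the standard word
  \<open>?\<beta>\<close>.\<close>

lemma mould_val_mult:
  assumes A: "A \<in> BIMU \<Gamma>" and B: "B \<in> BIMU \<Gamma>" and "distinct (map snd \<alpha>)"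
  shows "mould_val (mould_mult A B) \<alpha> = conv (mould_val A) (mould_val B) \<alpha>"
proof -
  let ?\<beta> = "zip (map fst \<alpha>) [0..<length \<alpha>]"
  obtain \<rho> where \<rho>: "inj \<rho>" "\<And>j. j < length \<alpha> \<Longrightarrow> \<rho> j = snd (\<alpha> ! j)"
    using distinct_imp_injective_extension[OF assms(3)] by auto
  have \<alpha>: "map (map_prod id \<rho>) ?\<beta> = \<alpha>"
    by (rule nth_equalityI) (simp_all add: \<rho> prod_eq_iff)
  have *: "distinct (map snd ?\<beta>)" by simp
  have take: "rename \<rho> (mould_val A (take i ?\<beta>)) = mould_val A (map (map_prod id \<rho>) (take i ?\<beta>))" for i
    using * by (intro mould_val_map[OF A \<rho>(1), symmetric]) (simp only: take_map[symmetric] distinct_take)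
  have drop: "rename \<rho> (mould_val B (drop i ?\<beta>)) = mould_val B (map (map_prod id \<rho>) (drop i ?\<beta>))" for i
    using * by (intro mould_val_map[OF B \<rho>(1), symmetric]) (simp only: drop_map[symmetric] distinct_drop)
  have "mould_val (mould_mult A B) \<alpha> = rename \<rho> (mould_mult A B (map fst \<alpha>))"
    by (rule mould_val_eq_rename[OF mould_mult_BIMU[OF A B] \<rho>])
  also have "\<dots> = conv (\<lambda>\<beta>. mould_val A (map (map_prod id \<rho>) \<beta>)) (\<lambda>\<beta>. mould_val B (map (map_prod id \<rho>) \<beta>)) ?\<beta>"
    unfolding mould_mult_eq_val conv_def rename_sum[OF \<rho>(1)] rename_mult[OF \<rho>(1)]
    by (simp add: take drop)
  also have "\<dots> = conv (mould_val A) (mould_val B) (map (map_prod id \<rho>) ?\<beta>)"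
    by (simp add: conv_def take_map drop_map)
  finally show ?thesis unfolding \<alpha> .
qed

lemma mould_val_standard:
  assumes "M \<in> BIMU \<Gamma>"
  shows "mould_val M (zip \<sigma>s [0..<length \<sigma>s]) = M \<sigma>s"
  by (subst mould_val_eq_rename[OF assms, of id]) auto

lemma mould_val_power:
  assumes "A \<in> BIMU \<Gamma>"
  shows "distinct (map snd \<alpha>) \<Longrightarrow> mould_val (mould_power A k) \<alpha> = conv_power (mould_val A) k \<alpha>"
proof (induction k arbitrary: \<alpha>)
  case 0
  then show ?case
    by (cases \<alpha>) (simp_all add: mould_val_def mould_at_def mould_one_def conv_one_def
      ratfun_subst_Fract[of _ 1 1, simplified fract_collapse, simplified])
next
  case (Suc k)
  then show ?case
    by (auto simp: mould_val_mult[OF assms mould_power_BIMU[OF assms]] take_map[symmetric]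
        drop_map[symmetric] intro!: conv_cong)
qed

lemma mould_power_eq_0:
  assumes "A [] = 0"
  shows "length \<sigma>s < k \<Longrightarrow> mould_power A k \<sigma>s = 0"
proof (induction k arbitrary: \<sigma>s)
  case (Suc k)
  have "A (take i \<sigma>s) = 0 \<or> mould_power A k (drop i \<sigma>s) = 0" if "i \<le> length \<sigma>s" for i
    using that Suc assms by (cases i) auto
  then have "mould_at A (take i \<sigma>s) v * mould_at (mould_power A k) (drop i \<sigma>s) w = 0"
    if "i \<le> length \<sigma>s" for i v w
    using that by (metis mould_at_0 mult_zero_left mult_zero_right)
  then show ?case unfolding mould_power.simps mould_mult_eq by (intro sum.neutral ballI) auto
qed simp

section \<open>Exponential and logarithm of moulds\<close>

abbreviation exp_coeff :: "nat \<Rightarrow> ratfun" where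
  "exp_coeff k \<equiv> rat_const (1 / fact k)"

lemma mould_exp_eq:
  assumes "A [] = 0"
  shows "mould_exp A \<sigma>s = (\<Sum>k\<le>length \<sigma>s. exp_coeff k * mould_power A k \<sigma>s)"
  unfolding mould_exp_def
  by (rule Sum_any.expand_superset) (auto simp: not_le[symmetric] intro: mould_power_eq_0[of A, OF assms])

lemma mould_exp_GARI:
  assumes "A \<in> ARI \<Gamma>"
  shows "mould_exp A \<in> GARI \<Gamma>"
proof -
  have A: "A \<in> BIMU \<Gamma>" "A [] = 0" using assms by (auto simp: ARI_def)
  have "mould_power A k \<in> BIMU \<Gamma>" for k by (rule mould_power_BIMU[OF A(1)])
  then show ?thesis
    by (auto simp: GARI_def BIMU_iff mould_exp_eq[of A, OF A(2)] mould_one_def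
        intro!: ratfuns_sum ratfuns_mult)
qed

lemma mould_val_exp:
  assumes "A \<in> ARI \<Gamma>" and "distinct (map snd \<alpha>)"
  shows "mould_val (mould_exp A) \<alpha> = conv_exp exp_coeff (mould_val A) \<alpha>"
proof -
  have A: "A \<in> BIMU \<Gamma>" "A [] = 0" using assms by (auto simp: ARI_def)
  have E: "mould_exp A \<in> BIMU \<Gamma>" using mould_exp_GARI[OF assms(1)] by (simp add: GARI_def)
  obtain \<rho> where \<rho>: "inj \<rho>" "\<And>j. j < length \<alpha> \<Longrightarrow> \<rho> j = snd (\<alpha> ! j)"
    using distinct_imp_injective_extension[OF assms(2)] by auto
  have "mould_val (mould_exp A) \<alpha> =
      (\<Sum>k\<le>length \<alpha>. exp_coeff k * rename \<rho> (mould_power A k (map fst \<alpha>)))"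
    by (simp add: mould_val_eq_rename[OF E \<rho>] mould_exp_eq[of A, OF A(2)] rename_sum \<rho> rename_mult)
  also have "\<dots> = conv_exp exp_coeff (mould_val A) \<alpha>"
    unfolding conv_exp_def
    by (simp add: mould_val_power[OF A(1) assms(2), symmetric]
        mould_val_eq_rename[OF mould_power_BIMU[OF A(1)] \<rho>])
  finally show ?thesis .
qed

text \<open>
  The truncation only serves the termination proof: a power with exponent at least 2 of a mould
  vanishing at the empty list depends on values at shorter lists only.
\<close>

function mould_log :: "'g mould \<Rightarrow> 'g mould" where
  "mould_log B \<sigma>s = (if \<sigma>s = [] then 0 else B \<sigma>s - (\<Sum>k=2..length \<sigma>s. exp_coeff k *
     mould_power (\<lambda>\<tau>s. if length \<tau>s < length \<sigma>s then mould_log B \<tau>s else 0) k \<sigma>s))"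
  by auto
termination by (relation "measure (\<lambda>(B, \<sigma>s). length \<sigma>s)") auto

declare mould_log.simps [simp del]

lemma mould_at_cong: "M \<sigma>s = N \<sigma>s \<Longrightarrow> mould_at M \<sigma>s ws = mould_at N \<sigma>s ws"
  by (simp add: mould_at_def)

text \<open>A cut with the whole list on one side has the empty list on the other, where
  \<open>A\<close>, or the remaining positive power of \<open>A\<close>, is 0. Hence values at
  length \<open>n\<close> matter for exponent 1 only.\<close>

lemma mould_power_cong:
  assumes "A [] = 0" "A' [] = 0" and *: "\<And>\<sigma>s. length \<sigma>s < n \<Longrightarrow> A \<sigma>s = A' \<sigma>s"
    and "length \<sigma>s < n \<or> length \<sigma>s = n \<and> k \<noteq> 1"
  shows "mould_power A k \<sigma>s = mould_power A' k \<sigma>s"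
  using assms(4)
proof (induction k arbitrary: \<sigma>s)
  case (Suc k)
  show ?case
    unfolding mould_power.simps mould_mult_eq
  proof (intro sum.cong refl)
    fix i assume i: "i \<in> {..length \<sigma>s}"
    let ?l = "\<lambda>A. mould_at A (take i \<sigma>s) (map lin_var [0..<i])"
    let ?r = "\<lambda>B. mould_at B (drop i \<sigma>s) (map lin_var [i..<length \<sigma>s])"
    consider "i = 0" | "i = length \<sigma>s" "k \<noteq> 0" | "length (take i \<sigma>s) < n" "length (drop i \<sigma>s) < n"
      using Suc.prems i by (cases "i = 0"; cases "i = length \<sigma>s") auto
    then show "?l A * ?r (mould_power A k) = ?l A' * ?r (mould_power A' k)"
    proof cases
      case 1
      then show ?thesis using assms by (simp add: mould_at_0)
    next
      case 2
      then have "?r (mould_power A k) = 0" "?r (mould_power A' k) = 0"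
        using mould_power_eq_0[of A "[]" k] mould_power_eq_0[of A' "[]" k] assms by (simp_all add: mould_at_0)
      then show ?thesis by simp
    next
      case 3
      have "?l A = ?l A'" by (rule mould_at_cong) (rule *[OF 3(1)])
      moreover have "?r (mould_power A k) = ?r (mould_power A' k)"
        by (rule mould_at_cong) (use Suc.IH 3 in blast)
      ultimately show ?thesis by simp
    qed
  qed
qed simp

lemma mould_log_Nil [simp]: "mould_log B [] = 0"
  by (simp add: mould_log.simps)

lemma mould_log_ARI:
  assumes "B \<in> BIMU \<Gamma>"
  shows "mould_log B \<in> ARI \<Gamma>"
proof -
  have "mould_log B \<sigma>s \<in> ratfuns (length \<sigma>s) \<and> (\<not> set \<sigma>s \<subseteq> carrier \<Gamma> \<longrightarrow> mould_log B \<sigma>s = 0)" for \<sigma>s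
  proof (induction \<sigma>s rule: length_induct)
    case (1 \<sigma>s)
    let ?A = "\<lambda>\<tau>s. if length \<tau>s < length \<sigma>s then mould_log B \<tau>s else 0"
    \<comment> \<open>Truncation turns the hypothesis for shorter lists into membership of an entire
      mould, so closure under powers applies.\<close>
    have "?A \<in> BIMU \<Gamma>" unfolding BIMU_iff using 1 by simp
    then have "mould_power ?A k \<in> BIMU \<Gamma>" for k by (rule mould_power_BIMU)
    with assms show ?case
      by (subst (1 2) mould_log.simps)
         (auto simp: BIMU_iff intro!: ratfuns_diff ratfuns_sum ratfuns_mult)
  qed
  then show ?thesis by (simp add: ARI_def BIMU_iff)
qed

lemma mould_power_1:
  assumes "A \<in> BIMU \<Gamma>"
  shows "mould_power A (Suc 0) \<sigma>s = A \<sigma>s"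
proof -
  have "mould_power A (Suc 0) \<sigma>s = conv (mould_val A) (mould_val mould_one) (zip \<sigma>s [0..<length \<sigma>s])"
    by (simp add: mould_mult_eq_val)
  also have "\<dots> = (\<Sum>i\<in>{length \<sigma>s}. mould_val A (take i (zip \<sigma>s [0..<length \<sigma>s])))"
    unfolding conv_def
  proof (rule sum.mono_neutral_cong_right)
    have "mould_val mould_one \<alpha> = (if \<alpha> = [] then 1 else 0)" for \<alpha> :: "('a \<times> nat) list"
      using ratfun_subst_Fract[of _ 1 1] by (simp add: mould_val_def mould_at_def mould_one_def fract_collapse)
    then have one: "mould_val mould_one (drop i (zip \<sigma>s [0..<length \<sigma>s])) = (if length \<sigma>s \<le> i then 1 else 0)" for i
      by simp
    show "\<forall>i\<in>{..length (zip \<sigma>s [0..<length \<sigma>s])} - {length \<sigma>s}.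
        mould_val A (take i (zip \<sigma>s [0..<length \<sigma>s])) * mould_val mould_one (drop i (zip \<sigma>s [0..<length \<sigma>s])) = 0"
      by (auto simp: one)
    show "mould_val A (take i (zip \<sigma>s [0..<length \<sigma>s])) * mould_val mould_one (drop i (zip \<sigma>s [0..<length \<sigma>s])) =
        mould_val A (take i (zip \<sigma>s [0..<length \<sigma>s]))" if "i \<in> {length \<sigma>s}" for i
      using that by (simp only: one) simp
  qed auto
  also have "\<dots> = A \<sigma>s" by (simp add: mould_val_standard[OF assms])
  finally show ?thesis .
qed

lemma mould_exp_log:
  fixes B :: "'g mould"
  assumes B: "B \<in> GARI \<Gamma>"
  shows "mould_exp (mould_log B) = B"
proof
  fix \<sigma>s :: "'g list"
  let ?A = "mould_log B"
  let ?A' = "\<lambda>\<tau>s. if length \<tau>s < length \<sigma>s then ?A \<tau>s else 0"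
  have A: "?A \<in> BIMU \<Gamma>" using mould_log_ARI[of B \<Gamma>] B by (simp add: ARI_def GARI_def)
  show "mould_exp ?A \<sigma>s = B \<sigma>s"
  proof (cases "\<sigma>s = []")
    case True
    then show ?thesis using B by (simp add: mould_exp_eq mould_one_def GARI_def)
  next
    case False
    \<comment> \<open>The term \<open>k = 0\<close> vanishes at a nonempty list and
      \<open>k = 1\<close> is the logarithm itself; the rest is what \<open>mould_log\<close>
      subtracts.\<close>
    have "{..length \<sigma>s} = {0, 1} \<union> {2..length \<sigma>s}" using False by (cases \<sigma>s) auto
    then have "mould_exp ?A \<sigma>s =
        (\<Sum>k\<in>{0, 1}. exp_coeff k * mould_power ?A k \<sigma>s) + (\<Sum>k=2..length \<sigma>s. exp_coeff k * mould_power ?A k \<sigma>s)"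
      unfolding mould_exp_eq[of ?A, OF mould_log_Nil] by (simp add: sum.union_disjoint)
    also have "(\<Sum>k\<in>{0, 1}. exp_coeff k * mould_power ?A k \<sigma>s) = ?A \<sigma>s"
      using False mould_power_1[OF A] by (simp add: mould_one_def)
    also have "(\<Sum>k=2..length \<sigma>s. exp_coeff k * mould_power ?A k \<sigma>s) =
        (\<Sum>k=2..length \<sigma>s. exp_coeff k * mould_power ?A' k \<sigma>s)"
      by (intro sum.cong refl arg_cong2[where f = "(*)"] mould_power_cong[where n = "length \<sigma>s"]) auto
    also have "?A \<sigma>s + \<dots> = B \<sigma>s"
      using False by (subst mould_log.simps) simp
    finally show ?thesis .
  qed
qed

text \<open>Every element of \<open>GARI\<close> is the exponential of its \<open>mould_log\<close>,
  so equality of the sets reduces to an equivalence for each single \<open>A\<close>.\<close>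

lemma mould_exp_image:
  assumes "\<And>A. A \<in> ARI \<Gamma> \<Longrightarrow> P' (mould_exp A) \<longleftrightarrow> P A"
  shows "mould_exp ` {A \<in> ARI \<Gamma>. P A} = {B \<in> GARI \<Gamma>. P' B}"
proof (intro equalityI subsetI)
  fix B assume "B \<in> {B \<in> GARI \<Gamma>. P' B}"
  then have "B = mould_exp (mould_log B)" "mould_log B \<in> {A \<in> ARI \<Gamma>. P A}"
    using mould_exp_log[of B \<Gamma>] mould_log_ARI[of B \<Gamma>] assms[of "mould_log B"] by (auto simp: GARI_def)
  then show "B \<in> mould_exp ` {A \<in> ARI \<Gamma>. P A}" by (rule image_eqI)
qed (use assms mould_exp_GARI in auto)

section \<open>The two shuffle products\<close>

text \<open>The map \<open>h\<close> embeds coefficients: \<open>rat_const\<close> for rational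
  shuffle coefficients, the identity for those in the field.\<close>

definition lin_ext :: "('c \<Rightarrow> 'k) \<Rightarrow> ('a list \<Rightarrow> 'k) \<Rightarrow> ('a list \<Rightarrow>\<^sub>0 'c::comm_ring_1) \<Rightarrow> 'k::comm_ring_1" where
  "lin_ext h F x = Sum_any (\<lambda>\<alpha>. h (Poly_Mapping.lookup x \<alpha>) * F \<alpha>)"

context
  fixes h :: "'c::comm_ring_1 \<Rightarrow> 'k::comm_ring_1"
  assumes h_0: "h 0 = 0" and h_1: "h 1 = 1" and h_add: "\<And>a b. h (a + b) = h a + h b"
begin

lemma lin_ext_superset:
  assumes "finite T" "Poly_Mapping.keys x \<subseteq> T"
  shows "lin_ext h F x = (\<Sum>\<alpha>\<in>T. h (Poly_Mapping.lookup x \<alpha>) * F \<alpha>)"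
proof -
  have "Poly_Mapping.lookup x \<alpha> = 0" if "\<alpha> \<notin> T" for \<alpha>
    using that assms(2) by (meson in_keys_iff subsetD)
  then show ?thesis
    unfolding lin_ext_def
    by (intro Sum_any.expand_superset[OF assms(1)] subsetI) (metis (mono_tags) h_0 mem_Collect_eq mult_zero_left)
qed

lemma lin_ext_single: "lin_ext h F (Poly_Mapping.single \<alpha> c) = h c * F \<alpha>"
  by (subst lin_ext_superset[of "{\<alpha>}"]) simp_all

lemma lin_ext_0: "lin_ext h F 0 = 0"
  by (simp add: lin_ext_superset[of "{}"])

lemma lin_ext_add: "lin_ext h F (x + y) = lin_ext h F x + lin_ext h F y"
proof -
  let ?T = "Poly_Mapping.keys x \<union> Poly_Mapping.keys y"
  have "Poly_Mapping.keys (x + y) \<subseteq> ?T" by (rule keys_add)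
  then show ?thesis
    by (simp add: lin_ext_superset[of ?T] lookup_add h_add sum.distrib algebra_simps)
qed

lemma lin_ext_lcons: "lin_ext h F (lcons a x) = lin_ext h (\<lambda>\<alpha>. F (a # \<alpha>)) x"
proof -
  have "lin_ext h F (\<Sum>\<omega>\<in>T. Poly_Mapping.single (a # \<omega>) (f \<omega>)) = (\<Sum>\<omega>\<in>T. h (f \<omega>) * F (a # \<omega>))"
    for T f
    by (induction T rule: infinite_finite_induct) (simp_all add: lin_ext_0 lin_ext_add lin_ext_single)
  then show ?thesis
    by (simp add: lcons_def lin_ext_superset[OF finite_keys order_refl])
qed

text \<open>With contraction coefficient 0 the letters \<open>l\<close> and \<open>r\<close> are
  free; they are later taken as for the other product, so that one family covers both.\<close>

lemma lin_ext_shuffle: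
  "lin_ext h F (shuffle (map f \<omega>) (map f \<eta>)) =
     quasi_shuffle.qsh (\<lambda>_ _. 0) l r (\<lambda>\<alpha>. F (map f \<alpha>)) \<omega> \<eta>"
  by (induction \<omega> \<eta> arbitrary: F rule: shuffle.induct)
     (simp_all add: quasi_shuffle.qsh.simps lin_ext_single h_1 lin_ext_add lin_ext_lcons)

end

lemma lookup_scale: "Poly_Mapping.lookup (scale c x) \<alpha> = c * Poly_Mapping.lookup x \<alpha>"
  by (simp add: scale_def Poly_Mapping.map.rep_eq when_def)

lemma lin_ext_scale: "lin_ext (\<lambda>a. a) F (scale c x) = c * lin_ext (\<lambda>a. a) F x"
proof -
  have "Poly_Mapping.keys (scale c x) \<subseteq> Poly_Mapping.keys x"
    by (auto simp: in_keys_iff lookup_scale)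
  then show ?thesis
    by (simp add: lin_ext_superset[of "\<lambda>a. a" "Poly_Mapping.keys x"] lookup_scale sum_distrib_left mult_ac)
qed

lemma lin_ext_diff: "lin_ext (\<lambda>a. a) F (x - y) = lin_ext (\<lambda>a. a) F x - lin_ext (\<lambda>a. a) F y"
  using lin_ext_add[of "\<lambda>a. a" F "x - y" y] by simp

definition stuffle_coeff :: "rat \<Rightarrow> 'g \<times> nat \<Rightarrow> 'g \<times> nat \<Rightarrow> ratfun" where
  "stuffle_coeff c a b = rat_const c / (ratfun_var (snd a) - ratfun_var (snd b))"

definition stuffle_left :: "('g, 'b) monoid_scheme \<Rightarrow> 'g \<times> nat \<Rightarrow> 'g \<times> nat \<Rightarrow> 'g \<times> nat" where
  "stuffle_left \<Gamma> a b = (fst a \<otimes>\<^bsub>\<Gamma>\<^esub> fst b, snd a)"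

definition stuffle_right :: "('g, 'b) monoid_scheme \<Rightarrow> 'g \<times> nat \<Rightarrow> 'g \<times> nat \<Rightarrow> 'g \<times> nat" where
  "stuffle_right \<Gamma> a b = (fst a \<otimes>\<^bsub>\<Gamma>\<^esub> fst b, snd b)"

lemma snd_stuffle_left [simp]: "snd (stuffle_left \<Gamma> a b) = snd a"
  and snd_stuffle_right [simp]: "snd (stuffle_right \<Gamma> a b) = snd b"
  by (simp_all add: stuffle_left_def stuffle_right_def)

text \<open>\<open>c = 0\<close> gives the shuffle product and \<open>c = 1\<close> the product \<open>shuffle_star\<close>.\<close>

abbreviation stuffle :: "('g, 'b) monoid_scheme \<Rightarrow> rat \<Rightarrow> (('g \<times> nat) list \<Rightarrow> ratfun) \<Rightarrow>
    ('g \<times> nat) list \<Rightarrow> ('g \<times> nat) list \<Rightarrow> ratfun" where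
  "stuffle \<Gamma> c \<equiv> quasi_shuffle.qsh (stuffle_coeff c) (stuffle_left \<Gamma>) (stuffle_right \<Gamma>)"

abbreviation stuffle_words :: "('g, 'b) monoid_scheme \<Rightarrow>
    ('g \<times> nat) list \<Rightarrow> ('g \<times> nat) list \<Rightarrow> ('g \<times> nat) list set" where
  "stuffle_words \<Gamma> \<equiv> quasi_shuffle.qsh_words (stuffle_left \<Gamma>) (stuffle_right \<Gamma>)"

lemmas stuffle_simps = quasi_shuffle.qsh.simps
lemmas stuffle_words_simps = quasi_shuffle.qsh_words.simps

lemma lin_var_eq_iff: "lin_var i = lin_var j \<longleftrightarrow> i = j"
  by (metis lookup_single_eq lookup_single_not_eq zero_neq_one)

text \<open>Disjointness of the variables passes to the recursive calls and excludes the branch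
  \<open>v = v'\<close> throughout.\<close>

lemma lin_ext_shuffle_star:
  fixes \<Gamma> :: "('g, 'b) monoid_scheme"
  defines "f \<equiv> map_prod id lin_var"
  shows "snd ` set \<omega> \<inter> snd ` set \<eta> = {} \<Longrightarrow>
    lin_ext (\<lambda>a. a) F (shuffle_star \<Gamma> (map f \<omega>) (map f \<eta>)) = stuffle \<Gamma> 1 (\<lambda>\<alpha>. F (map f \<alpha>)) \<omega> \<eta>"
proof (induction \<omega> \<eta> arbitrary: F rule: quasi_shuffle.qsh_words.induct)
  case (3 a \<omega> b \<eta>)
  obtain \<sigma> i \<tau> j where ab: "a = (\<sigma>, i)" "b = (\<tau>, j)" by fastforce
  have f: "f (\<rho>, k) = (\<rho>, lin_var k)" for \<rho> k by (simp add: f_def)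
  have "lin_var i \<noteq> lin_var j" using "3.prems" ab by (simp add: lin_var_eq_iff)
  moreover have "snd ` set \<omega> \<inter> snd ` set (b # \<eta>) = {}" "snd ` set (a # \<omega>) \<inter> snd ` set \<eta> = {}"
    "snd ` set \<omega> \<inter> snd ` set \<eta> = {}"
    using "3.prems" by auto
  note IH = 3(1)[OF this(1)] 3(2)[OF this(2)] 3(3)[OF this(3)]
  ultimately show ?case
    using IH unfolding list.map ab f
    by (simp add: f stuffle_simps stuffle_coeff_def stuffle_left_def stuffle_right_def
        lin_ext_add lin_ext_diff lin_ext_scale lin_ext_lcons)
qed (simp_all add: lin_ext_single stuffle_simps)

text \<open>A contraction consumes two letters and keeps the variable of one of them, so no variable
  is repeated.\<close>

lemma distinct_stuffle_words:
  assumes "\<alpha> \<in> stuffle_words \<Gamma> \<omega> \<eta>" "distinct (map snd (\<omega> @ \<eta>))"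
  shows "distinct (map snd \<alpha>) \<and> snd ` set \<alpha> \<subseteq> snd ` set (\<omega> @ \<eta>)"
  using assms
proof (induction \<omega> \<eta> arbitrary: \<alpha> rule: quasi_shuffle.qsh_words.induct)
  case (3 a \<omega> b \<eta>)
  have "distinct (map snd (\<omega> @ b # \<eta>))" "distinct (map snd ((a # \<omega>) @ \<eta>))" "distinct (map snd (\<omega> @ \<eta>))"
    using "3.prems"(2) by auto
  note IH = 3(1)[OF _ this(1)] 3(2)[OF _ this(2)] 3(3)[OF _ this(3)]
  from "3.prems"(1) consider \<beta> where "\<alpha> = a # \<beta>" "\<beta> \<in> stuffle_words \<Gamma> \<omega> (b # \<eta>)"
    | \<beta> where "\<alpha> = b # \<beta>" "\<beta> \<in> stuffle_words \<Gamma> (a # \<omega>) \<eta>"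
    | \<beta> where "\<alpha> = stuffle_left \<Gamma> a b # \<beta>" "\<beta> \<in> stuffle_words \<Gamma> \<omega> \<eta>"
    | \<beta> where "\<alpha> = stuffle_right \<Gamma> a b # \<beta>" "\<beta> \<in> stuffle_words \<Gamma> \<omega> \<eta>"
    by (auto simp: stuffle_words_simps)
  then show ?case
  proof cases
    case 1
    moreover have "snd a \<notin> snd ` set (\<omega> @ b # \<eta>)" using "3.prems"(2)  by auto
    ultimately show ?thesis using IH(1)[of \<beta>] by auto
  next
    case 2
    moreover have "snd b \<notin> snd ` set ((a # \<omega>) @ \<eta>)" using "3.prems"(2)  by auto
    ultimately show ?thesis using IH(2)[of \<beta>] by auto
  next
    case 3
    moreover have "snd a \<notin> snd ` set (\<omega> @ \<eta>)" using "3.prems"(2) by auto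
    ultimately show ?thesis using IH(3)[of \<beta>] by auto
  next
    case 4
    moreover have "snd b \<notin> snd ` set (\<omega> @ \<eta>)" using "3.prems"(2) by auto
    ultimately show ?thesis using IH(3)[of \<beta>] by auto
  qed
qed (auto simp: stuffle_words_simps)

text \<open>Contracted letters and the coefficient \<open>stuffle_coeff\<close> are themselves
  compatible with renaming, so compatibility of \<open>F\<close> and \<open>G\<close> on the
  occurring words is enough.\<close>

lemma stuffle_map:
  fixes \<Gamma> :: "('g, 'b) monoid_scheme"
  defines "f \<equiv> map_prod id"
  assumes \<pi>: "inj \<pi>"
  shows "(\<And>\<alpha>. \<alpha> \<in> stuffle_words \<Gamma> \<omega> \<eta> \<Longrightarrow> G (map (f \<pi>) \<alpha>) = rename \<pi> (F \<alpha>)) \<Longrightarrow>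
    stuffle \<Gamma> c G (map (f \<pi>) \<omega>) (map (f \<pi>) \<eta>) = rename \<pi> (stuffle \<Gamma> c F \<omega> \<eta>)"
proof (induction \<omega> \<eta> arbitrary: F G rule: quasi_shuffle.qsh_words.induct)
  case (3 a \<omega> b \<eta>)
  have letters: "stuffle_left \<Gamma> (f \<pi> a) (f \<pi> b) = f \<pi> (stuffle_left \<Gamma> a b)"
    "stuffle_right \<Gamma> (f \<pi> a) (f \<pi> b) = f \<pi> (stuffle_right \<Gamma> a b)"
    "stuffle_coeff c (f \<pi> a) (f \<pi> b) = rename \<pi> (stuffle_coeff c a b)"
    by (simp_all add: f_def stuffle_left_def stuffle_right_def stuffle_coeff_def
        rename_divide[OF \<pi>] rename_diff[OF \<pi>] \<pi>)
  note FG = "3.prems"[unfolded stuffle_words_simps]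
  have "stuffle \<Gamma> c (\<lambda>\<alpha>. G (f \<pi> a # \<alpha>)) (map (f \<pi>) \<omega>) (map (f \<pi>) (b # \<eta>)) =
      rename \<pi> (stuffle \<Gamma> c (\<lambda>\<alpha>. F (a # \<alpha>)) \<omega> (b # \<eta>))"
    by (rule 3(1)) (use FG[of "a # _"] in auto)
  moreover have "stuffle \<Gamma> c (\<lambda>\<alpha>. G (f \<pi> b # \<alpha>)) (map (f \<pi>) (a # \<omega>)) (map (f \<pi>) \<eta>) =
      rename \<pi> (stuffle \<Gamma> c (\<lambda>\<alpha>. F (b # \<alpha>)) (a # \<omega>) \<eta>)"
    by (rule 3(2)) (use FG[of "b # _"] in auto)
  moreover have "stuffle \<Gamma> c (\<lambda>\<alpha>. G (f \<pi> (s \<Gamma> a b) # \<alpha>)) (map (f \<pi>) \<omega>) (map (f \<pi>) \<eta>) =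
      rename \<pi> (stuffle \<Gamma> c (\<lambda>\<alpha>. F (s \<Gamma> a b # \<alpha>)) \<omega> \<eta>)"
    if "s \<in> {stuffle_left, stuffle_right}" for s
    by (rule 3(3)) (use FG[of "s \<Gamma> a b # _"] that in auto)
  ultimately show ?case
    by (simp add: stuffle_simps letters rename_add[OF \<pi>] rename_mult[OF \<pi>] rename_diff[OF \<pi>])
qed (simp_all add: stuffle_simps stuffle_words_simps)

section \<open>Symmetry types\<close>

text \<open>This is the class \<open>Q\<close> of the abstract equivalence.\<close>

definition disjoint_words :: "('g, 'b) monoid_scheme \<Rightarrow> ('g \<times> nat) list \<Rightarrow> ('g \<times> nat) list \<Rightarrow> bool" where
  "disjoint_words \<Gamma> \<omega> \<eta> \<longleftrightarrow> distinct (map snd (\<omega> @ \<eta>)) \<and> fst ` set (\<omega> @ \<eta>) \<subseteq> carrier \<Gamma>"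

definition standard_word :: "(nat \<Rightarrow> 'g) \<Rightarrow> nat \<Rightarrow> nat \<Rightarrow> ('g \<times> nat) list" where
  "standard_word \<sigma> i j = map (\<lambda>k. (\<sigma> k, k)) [i..<j]"

lemma disjoint_words_subset:
  assumes "disjoint_words \<Gamma> \<omega> \<eta>" "distinct (map snd \<omega>')" "distinct (map snd \<eta>')"
    and "set \<omega>' \<subseteq> set \<omega>" "set \<eta>' \<subseteq> set \<eta>"
  shows "disjoint_words \<Gamma> \<omega>' \<eta>'"
proof -
  have "snd ` set \<omega>' \<inter> snd ` set \<eta>' \<subseteq> snd ` set \<omega> \<inter> snd ` set \<eta>"
    by (intro Int_mono image_mono assms)
  also have "\<dots> = {}"
    using assms(1) by (simp add: disjoint_words_def)
  finally have "snd ` set \<omega>' \<inter> snd ` set \<eta>' = {}" by (simp only: subset_empty)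
  moreover have "fst ` set \<omega>' \<subseteq> carrier \<Gamma>"
    using assms(1) by (intro subset_trans[OF image_mono[OF assms(4)]]) (simp add: disjoint_words_def image_Un)
  moreover have "fst ` set \<eta>' \<subseteq> carrier \<Gamma>"
    using assms(1) by (intro subset_trans[OF image_mono[OF assms(5)]]) (simp add: disjoint_words_def image_Un)
  ultimately show ?thesis using assms(2,3) by (simp add: disjoint_words_def image_Un)
qed

lemma disjoint_words_take: "disjoint_words \<Gamma> \<omega> \<eta> \<Longrightarrow> disjoint_words \<Gamma> (take i \<omega>) (take j \<eta>)"
  by (rule disjoint_words_subset, assumption)
     (auto simp: disjoint_words_def distinct_take set_take_subset simp flip: take_map)

lemma disjoint_words_drop: "disjoint_words \<Gamma> \<omega> \<eta> \<Longrightarrow> disjoint_words \<Gamma> (drop i \<omega>) (drop j \<eta>)"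
  by (rule disjoint_words_subset, assumption)
     (auto simp: disjoint_words_def distinct_drop set_drop_subset simp flip: drop_map)

text \<open>\<open>mould_exp A\<close> is known to give the exponential of the functional only at
  words in distinct variables; all words in the product of a disjoint pair are such.\<close>

lemma stuffle_exp_iff:
  assumes A: "A \<in> ARI \<Gamma>"
  shows "(\<forall>\<omega> \<eta>. disjoint_words \<Gamma> \<omega> \<eta> \<longrightarrow> \<omega> \<noteq> [] \<longrightarrow> \<eta> \<noteq> [] \<longrightarrow>
       stuffle \<Gamma> c (mould_val (mould_exp A)) \<omega> \<eta> = mould_val (mould_exp A) \<omega> * mould_val (mould_exp A) \<eta>)
     \<longleftrightarrow> (\<forall>\<omega> \<eta>. disjoint_words \<Gamma> \<omega> \<eta> \<longrightarrow> \<omega> \<noteq> [] \<longrightarrow> \<eta> \<noteq> [] \<longrightarrow> stuffle \<Gamma> c (mould_val A) \<omega> \<eta> = 0)"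
proof -
  have "stuffle \<Gamma> c (mould_val (mould_exp A)) \<omega> \<eta> = stuffle \<Gamma> c (conv_exp exp_coeff (mould_val A)) \<omega> \<eta>"
    "mould_val (mould_exp A) \<omega> = conv_exp exp_coeff (mould_val A) \<omega>"
    "mould_val (mould_exp A) \<eta> = conv_exp exp_coeff (mould_val A) \<eta>"
    if "disjoint_words \<Gamma> \<omega> \<eta>" for \<omega> \<eta>
    using that distinct_stuffle_words[of _ \<Gamma> \<omega> \<eta>]
    by (auto simp: disjoint_words_def intro!: quasi_shuffle.qsh_cong mould_val_exp[OF A])
  moreover have "(\<forall>\<omega> \<eta>. disjoint_words \<Gamma> \<omega> \<eta> \<longrightarrow> \<omega> \<noteq> [] \<longrightarrow> \<eta> \<noteq> [] \<longrightarrow>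
       stuffle \<Gamma> c (conv_exp exp_coeff (mould_val A)) \<omega> \<eta> =
       conv_exp exp_coeff (mould_val A) \<omega> * conv_exp exp_coeff (mould_val A) \<eta>)
     \<longleftrightarrow> (\<forall>\<omega> \<eta>. disjoint_words \<Gamma> \<omega> \<eta> \<longrightarrow> \<omega> \<noteq> [] \<longrightarrow> \<eta> \<noteq> [] \<longrightarrow> stuffle \<Gamma> c (mould_val A) \<omega> \<eta> = 0)"
  proof (rule quasi_shuffle.qsh_conv_exp_iff)
    show "mould_val A [] = 0" using A by (simp add: ARI_def mould_val_def mould_at_0)
    fix i k :: nat assume "i \<le> k"
    then have "of_nat (k choose i) * (1 / fact k) = (1 / fact i * (1 / fact (k - i)) :: rat)"
      by (simp add: binomial_fact)
    then show "of_nat (k choose i) * exp_coeff k = exp_coeff i * exp_coeff (k - i)"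
      by (metis rat_const_mult rat_const_of_nat)
  qed (simp_all add: disjoint_words_take disjoint_words_drop)
  ultimately show ?thesis by simp
qed

text \<open>A disjoint pair is the image of a standard pair under one injective renaming, which
  commutes with both sides and fixes \<open>rat_const t\<close>.\<close>

lemma standard_words_suffice:
  fixes M :: "'g mould" and c t :: rat
  assumes M: "M \<in> BIMU \<Gamma>"
  defines "R \<equiv> \<lambda>\<omega> \<eta>. stuffle \<Gamma> c (mould_val M) \<omega> \<eta> = rat_const t * (mould_val M \<omega> * mould_val M \<eta>)"
  shows "(\<forall>p\<ge>1. \<forall>q\<ge>1. \<forall>\<sigma>. (\<forall>i<p + q. \<sigma> i \<in> carrier \<Gamma>) \<longrightarrow>
       R (standard_word \<sigma> 0 p) (standard_word \<sigma> p (p + q)))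
     \<longleftrightarrow> (\<forall>\<omega> \<eta>. disjoint_words \<Gamma> \<omega> \<eta> \<longrightarrow> \<omega> \<noteq> [] \<longrightarrow> \<eta> \<noteq> [] \<longrightarrow> R \<omega> \<eta>)"
    (is "?L \<longleftrightarrow> ?R")
proof
  assume ?R
  show ?L
  proof (intro allI impI)
    fix p q :: nat and \<sigma> :: "nat \<Rightarrow> 'g"
    assume "1 \<le> p" "1 \<le> q" "\<forall>i<p + q. \<sigma> i \<in> carrier \<Gamma>"
    then have "disjoint_words \<Gamma> (standard_word \<sigma> 0 p) (standard_word \<sigma> p (p + q))"
      by (auto simp: disjoint_words_def standard_word_def comp_def)
    with \<open>1 \<le> p\<close> \<open>1 \<le> q\<close> \<open>?R\<close> show "R (standard_word \<sigma> 0 p) (standard_word \<sigma> p (p + q))"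
      by (simp add: standard_word_def)
  qed
next
  assume ?L
  show ?R
  proof (intro allI impI)
    fix \<omega> \<eta> :: "('g \<times> nat) list"
    assume "disjoint_words \<Gamma> \<omega> \<eta>" and ne: "\<omega> \<noteq> []" "\<eta> \<noteq> []"
    then have dist: "distinct (map snd (\<omega> @ \<eta>))" and car: "fst ` set (\<omega> @ \<eta>) \<subseteq> carrier \<Gamma>"
      by (simp_all add: disjoint_words_def)
    let ?p = "length \<omega>" and ?q = "length \<eta>"
    define \<sigma> where "\<sigma> k = fst ((\<omega> @ \<eta>) ! k)" for k
    let ?\<omega> = "standard_word \<sigma> 0 ?p" and ?\<eta> = "standard_word \<sigma> ?p (?p + ?q)"
    \<comment> \<open>One renaming must serve both words, so it is read off the concatenation, whose
      positions are the indices of the standard pair.\<close>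
    obtain \<pi> where \<pi>: "inj \<pi>" "\<And>j. j < ?p + ?q \<Longrightarrow> \<pi> j = snd ((\<omega> @ \<eta>) ! j)"
      using distinct_imp_injective_extension[OF dist] by (auto simp flip: map_append)
    have \<omega>: "\<omega> = map (map_prod id \<pi>) ?\<omega>"
      by (rule nth_equalityI) (simp_all add: standard_word_def \<sigma>_def \<pi> nth_append)
    have \<eta>: "\<eta> = map (map_prod id \<pi>) ?\<eta>"
      by (rule nth_equalityI) (simp_all add: standard_word_def \<sigma>_def \<pi> nth_append)
    have std: "distinct (map snd (?\<omega> @ ?\<eta>))" "distinct (map snd ?\<omega>)" "distinct (map snd ?\<eta>)"
      by (auto simp: standard_word_def comp_def)
    have "\<forall>i<?p + ?q. \<sigma> i \<in> carrier \<Gamma>"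
      using car unfolding \<sigma>_def by (metis image_subset_iff length_append nth_mem)
    then have "R ?\<omega> ?\<eta>" using \<open>?L\<close> ne by (simp add: Suc_le_eq)
    then have "rename \<pi> (stuffle \<Gamma> c (mould_val M) ?\<omega> ?\<eta>) =
        rat_const t * (rename \<pi> (mould_val M ?\<omega>) * rename \<pi> (mould_val M ?\<eta>))"
      by (simp add: R_def rename_mult[OF \<pi>(1)] \<pi>(1))
    also have "rename \<pi> (stuffle \<Gamma> c (mould_val M) ?\<omega> ?\<eta>) = stuffle \<Gamma> c (mould_val M) \<omega> \<eta>"
      by (subst \<omega>, subst \<eta>, rule stuffle_map[OF \<pi>(1), symmetric], rule mould_val_map[OF M \<pi>(1)])
         (use distinct_stuffle_words std(1) in blast)
    also have "rename \<pi> (mould_val M ?\<omega>) = mould_val M \<omega>"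
      by (subst \<omega>, rule mould_val_map[OF M \<pi>(1) std(2), symmetric])
    also have "rename \<pi> (mould_val M ?\<eta>) = mould_val M \<eta>"
      by (subst \<eta>, rule mould_val_map[OF M \<pi>(1) std(3), symmetric])
    finally show "R \<omega> \<eta>" by (simp add: R_def)
  qed
qed

text \<open>\<open>t = 0\<close> gives the alternal and alternil moulds, \<open>t = 1\<close> the symmetral and symmetril ones.\<close>

definition symmetry_type :: "('g, 'b) monoid_scheme \<Rightarrow> rat \<Rightarrow> rat \<Rightarrow> 'g mould \<Rightarrow> bool" where
  "symmetry_type \<Gamma> c t M \<longleftrightarrow> (\<forall>p\<ge>1. \<forall>q\<ge>1. \<forall>\<sigma>. (\<forall>i<p + q. \<sigma> i \<in> carrier \<Gamma>) \<longrightarrow>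
     stuffle \<Gamma> c (mould_val M) (standard_word \<sigma> 0 p) (standard_word \<sigma> p (p + q)) =
     rat_const t * (mould_val M (standard_word \<sigma> 0 p) * mould_val M (standard_word \<sigma> p (p + q))))"

lemma mould_exp_symmetry_type:
  "mould_exp ` {A \<in> ARI \<Gamma>. symmetry_type \<Gamma> c 0 A} = {B \<in> GARI \<Gamma>. symmetry_type \<Gamma> c 1 B}"
proof (rule mould_exp_image)
  fix A assume A: "A \<in> ARI \<Gamma>"
  then have "A \<in> BIMU \<Gamma>" "mould_exp A \<in> BIMU \<Gamma>"
    using mould_exp_GARI[of A \<Gamma>] by (auto simp: ARI_def GARI_def)
  then show "symmetry_type \<Gamma> c 1 (mould_exp A) \<longleftrightarrow> symmetry_type \<Gamma> c 0 A"
    unfolding symmetry_type_def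
    by (simp only: standard_words_suffice) (simp add: stuffle_exp_iff[OF A])
qed

section \<open>Translation of the defining conditions\<close>

definition u_letter :: "'g \<times> nat \<Rightarrow> 'g u_letter" where
  "u_letter x = (lin_var (snd x), fst x)"

lemma u_word_eq: "u_word \<sigma> i j = map u_letter (standard_word \<sigma> i j)"
  by (simp add: u_word_def standard_word_def u_letter_def)

lemma v_word_eq: "v_word \<sigma> i j = map (map_prod id lin_var) (standard_word \<sigma> i j)"
  by (simp add: v_word_def standard_word_def)

lemma mould_at_u_map: "mould_at_u M (map u_letter \<alpha>) = mould_val M \<alpha>"
  by (simp add: mould_at_u_def mould_val_def u_letter_def comp_def)

lemma mould_at_v_map: "mould_at_v M (map (map_prod id lin_var) \<alpha>) = mould_val M \<alpha>"
  by (simp add: mould_at_v_def mould_val_def comp_def)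

lemma stuffle_0:
  fixes \<Gamma> :: "('g, 'b) monoid_scheme"
  shows "stuffle \<Gamma> 0 = quasi_shuffle.qsh (\<lambda>_ _. 0) (stuffle_left \<Gamma>) (stuffle_right \<Gamma>)"
proof -
  have "stuffle_coeff 0 = (\<lambda>(_ :: 'g \<times> nat) _. 0 :: ratfun)" by (intro ext) (simp add: stuffle_coeff_def)
  then show ?thesis by simp
qed

lemma sum_Sh_u:
  "Sum_any (\<lambda>\<alpha>. rat_const (Sh_u (map u_letter \<omega>) (map u_letter \<eta>) \<alpha>) * mould_at_u M \<alpha>) =
     stuffle \<Gamma> 0 (mould_val M) \<omega> \<eta>"
  using lin_ext_shuffle[of rat_const "mould_at_u M" u_letter \<omega> \<eta>]
  by (simp add: lin_ext_def Sh_u_def stuffle_0 rat_const_add mould_at_u_map)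

lemma sum_Sh_v:
  "Sum_any (\<lambda>\<alpha>. Sh_v (map (map_prod id lin_var) \<omega>) (map (map_prod id lin_var) \<eta>) \<alpha> * mould_at_v M \<alpha>) =
     stuffle \<Gamma> 0 (mould_val M) \<omega> \<eta>"
  using lin_ext_shuffle[of "\<lambda>a. a" "mould_at_v M" "map_prod id lin_var" \<omega> \<eta>]
  by (simp add: lin_ext_def Sh_v_def stuffle_0 mould_at_v_map)

lemma sum_Sh_star:
  "Sum_any (\<lambda>\<alpha>. Sh_star \<Gamma> (map (map_prod id lin_var) (standard_word \<sigma> 0 p))
       (map (map_prod id lin_var) (standard_word \<sigma> p (p + q))) \<alpha> * mould_at_v M \<alpha>) =
     stuffle \<Gamma> 1 (mould_val M) (standard_word \<sigma> 0 p) (standard_word \<sigma> p (p + q))"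
proof -
  have "snd ` set (standard_word \<sigma> 0 p) \<inter> snd ` set (standard_word \<sigma> p (p + q)) = {}"
    by (auto simp: standard_word_def)
  from lin_ext_shuffle_star[OF this, of "mould_at_v M" \<Gamma>] show ?thesis
    by (simp add: lin_ext_def Sh_star_def mould_at_v_map)
qed

lemmas symmetry_unfold = symmetry_type_def Let_def u_word_eq v_word_eq mould_at_u_map mould_at_v_map
  sum_Sh_star ARI_bar_def GARI_bar_def ARI_def[symmetric] GARI_def[symmetric]

text \<open>Words in \<open>u\<close> and in \<open>v\<close> differ only in the order of the letter
  pairs; encoded by group element and index, they give the same conditions.\<close>

lemma symmetry_type_0:
  "ARI_al \<Gamma> = {M \<in> ARI \<Gamma>. symmetry_type \<Gamma> 0 0 M}"
  "GARI_as \<Gamma> = {M \<in> GARI \<Gamma>. symmetry_type \<Gamma> 0 1 M}"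
  "ARI_bar_al \<Gamma> = {M \<in> ARI \<Gamma>. symmetry_type \<Gamma> 0 0 M}"
  "GARI_bar_as \<Gamma> = {M \<in> GARI \<Gamma>. symmetry_type \<Gamma> 0 1 M}"
  unfolding ARI_al_def GARI_as_def ARI_bar_al_def GARI_bar_as_def symmetry_unfold
    sum_Sh_u[where \<Gamma> = \<Gamma>] sum_Sh_v[where \<Gamma> = \<Gamma>] by simp_all

lemma symmetry_type_1:
  "ARI_bar_il \<Gamma> = {M \<in> ARI \<Gamma>. symmetry_type \<Gamma> 1 0 M}"
  "GARI_bar_is \<Gamma> = {M \<in> GARI \<Gamma>. symmetry_type \<Gamma> 1 1 M}"
  unfolding ARI_bar_il_def GARI_bar_is_def symmetry_unfold by simp_all

theorem theorem2p12:
  fixes \<Gamma> :: "('g, 'b) monoid_scheme"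
  assumes "comm_group \<Gamma>" and "finite (carrier \<Gamma>)"
  shows "mould_exp ` ARI_al \<Gamma> = GARI_as \<Gamma> \<and>
         mould_exp ` ARI_bar_al \<Gamma> = GARI_bar_as \<Gamma> \<and>
         mould_exp ` ARI_bar_il \<Gamma> = GARI_bar_is \<Gamma>"
  unfolding symmetry_type_0 symmetry_type_1 by (simp add: mould_exp_symmetry_type)

end
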